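(* Let $G$ be a finite group with exponent $N$ (the smallest positive integer $N$ with $g^N=\mathrm{id}_G$ for all $g\in G$). Let $G$ act linearly on a lattice $M'\cong M\times\mathbb{Z}$ of rank $d+1$ such that the $\mathbb{Z}$-coordinate of every point of $M'$ is preserved, and let $P\subset M'\otimes_{\mathbb{Z}}\mathbb{R}$ be a $d$-dimensional $G$-invariant polytope with vertices in $M\times\{1\}$. For $t\ge 0$ let $\chi_{tP}$ be the character of the complex permutation representation of $G$ on $tP\cap M'$ (with $\chi_{0P}$ the trivial character). Then $$\sum_{t\ge 0}\chi_{tP}z^t=\frac{\tilde H(P;z)}{(1-z^N)^{d+1}},$$ where $\tilde H(P;z)$ is a polynomial in $z$ of degree at most $N(d+1)-1$ with coefficients in $R(G)\otimes_{\mathbb{Z}}\mathbb{Q}$.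
   Context: $R(G)$ denotes the character ring of $G$: the ring of class functions that are integer linear combinations of irreducible characters of $G$. *)

theory Defs
  imports
    "HOL-Analysis.Analysis"
    "HOL-Algebra.Group_Action"
    "HOL-Computational_Algebra.Computational_Algebra"
    "HOL-Library.Function_Division"
    "Jordan_Normal_Form.Matrix"
begin

definition group_exponent :: "('g, 'b) monoid_scheme \<Rightarrow> nat" where
  "group_exponent G = (LEAST n. 0 < n \<and> (\<forall>g\<in>carrier G. g [^]\<^bsub>G\<^esub> n = \<one>\<^bsub>G\<^esub>))"

subsection \<open>Complex representations and characters\<close>

definition matrix_rep :: "('g, 'b) monoid_scheme \<Rightarrow> nat \<Rightarrow> ('g \<Rightarrow> complex Matrix.mat) \<Rightarrow> bool" where
  "matrix_rep G n \<rho> \<longleftrightarrow>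
     (\<forall>g\<in>carrier G. \<rho> g \<in> carrier_mat n n) \<and>
     \<rho> \<one>\<^bsub>G\<^esub> = 1\<^sub>m n \<and>
     (\<forall>g\<in>carrier G. \<forall>h\<in>carrier G. \<rho> (g \<otimes>\<^bsub>G\<^esub> h) = \<rho> g * \<rho> h)"

definition invariant_subspace ::
    "('g, 'b) monoid_scheme \<Rightarrow> nat \<Rightarrow> ('g \<Rightarrow> complex Matrix.mat) \<Rightarrow> complex Matrix.vec set \<Rightarrow> bool" where
  "invariant_subspace G n \<rho> W \<longleftrightarrow>
     W \<subseteq> carrier_vec n \<and> 0\<^sub>v n \<in> W \<and>
     (\<forall>v\<in>W. \<forall>w\<in>W. v + w \<in> W) \<and>
     (\<forall>a. \<forall>v\<in>W. a \<cdot>\<^sub>v v \<in> W) \<and>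
     (\<forall>g\<in>carrier G. \<forall>v\<in>W. \<rho> g *\<^sub>v v \<in> W)"

definition irreducible_rep :: "('g, 'b) monoid_scheme \<Rightarrow> nat \<Rightarrow> ('g \<Rightarrow> complex Matrix.mat) \<Rightarrow> bool" where
  "irreducible_rep G n \<rho> \<longleftrightarrow>
     matrix_rep G n \<rho> \<and> 0 < n \<and>
     (\<forall>W. invariant_subspace G n \<rho> W \<longrightarrow> W = {0\<^sub>v n} \<or> W = carrier_vec n)"

text \<open>
  A function on \<open>G\<close> is encoded as a function on the whole type that vanishes outside
  \<^term>\<open>carrier G\<close>, so that equality of class functions is plain equality.  With the imported
  pointwise operations \<^typ>\<open>'g \<Rightarrow> complex\<close> is a commutative ring with a syntactic division; on
  formal power series over it, \<open>f / h\<close> is the genuine quotient when \<open>h\<close> has constant coefficient 1.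
\<close>

definition character :: "('g, 'b) monoid_scheme \<Rightarrow> ('g \<Rightarrow> complex Matrix.mat) \<Rightarrow> 'g \<Rightarrow> complex" where
  "character G \<rho> = (\<lambda>g. if g \<in> carrier G then \<Sum>i<dim_row (\<rho> g). \<rho> g $$ (i, i) else 0)"

definition irreducible_characters :: "('g, 'b) monoid_scheme \<Rightarrow> ('g \<Rightarrow> complex) set" where
  "irreducible_characters G = {character G \<rho> | n \<rho>. irreducible_rep G n \<rho>}"

definition character_ring :: "('g, 'b) monoid_scheme \<Rightarrow> ('g \<Rightarrow> complex) set" where
  "character_ring G =
     {(\<lambda>g. \<Sum>f\<in>S. of_int (c f) * f g) | S c.
        finite S \<and> S \<subseteq> irreducible_characters G}"

text \<open>
  \<open>R(G) \<otimes> \<rat>\<close>, realised as the rational span of \<open>R(G)\<close> inside the complex class functions; the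
  natural map onto this span is injective because irreducible characters are linearly
  independent over the complex numbers.
\<close>

definition rational_character_ring :: "('g, 'b) monoid_scheme \<Rightarrow> ('g \<Rightarrow> complex) set" where
  "rational_character_ring G =
     {(\<lambda>g. \<Sum>f\<in>S. of_rat (q f) * f g) | S q.
        finite S \<and> S \<subseteq> character_ring G}"

text \<open>
  The permutation representation on \<open>\<complex>\<^sup>X\<close>, \<open>g e\<^sub>x = e\<^bsub>gx\<^esub>\<close>, for a finite set \<open>X\<close>, written in the
  standard basis ordered by the enumeration \<^term>\<open>from_nat_into X\<close>, which is a bijection from
  \<^term>\<open>{..<card X}\<close> to \<open>X\<close>.
\<close>

definition permutation_rep :: "('g \<Rightarrow> 'x \<Rightarrow> 'x) \<Rightarrow> 'x set \<Rightarrow> 'g \<Rightarrow> complex Matrix.mat" where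
  "permutation_rep \<phi> X g =
     Matrix.mat (card X) (card X)
       (\<lambda>(i, j). if \<phi> g (from_nat_into X j) = from_nat_into X i then 1 else 0)"

subsection \<open>Lattices and dilated polytopes\<close>

text \<open>
  A lattice \<open>L\<close> whose real span is the whole ambient space \<open>'a\<close>, so that \<open>'a\<close> is
  \<open>L \<otimes> \<real>\<close> and the rank of \<open>L\<close> is \<open>DIM('a)\<close>.
\<close>

definition full_lattice :: "'a::euclidean_space set \<Rightarrow> bool" where
  "full_lattice L \<longleftrightarrow>
     (\<exists>B. independent B \<and> span B = UNIV \<and> L = range (\<lambda>c. \<Sum>b\<in>B. of_int (c b) *\<^sub>R b))"

text \<open>An action on \<open>L \<otimes> \<real>\<close> that is the linear extension of an action on the lattice \<open>L\<close>.\<close>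

definition linear_lattice_action ::
    "('g, 'b) monoid_scheme \<Rightarrow> ('g \<Rightarrow> 'a::euclidean_space \<Rightarrow> 'a) \<Rightarrow> 'a set \<Rightarrow> bool" where
  "linear_lattice_action G \<phi> L \<longleftrightarrow>
     group_action G UNIV \<phi> \<and> (\<forall>g\<in>carrier G. linear (\<phi> g) \<and> \<phi> g ` L = L)"

definition lattice_points_dilate :: "'a::real_vector set \<Rightarrow> 'a set \<Rightarrow> nat \<Rightarrow> 'a set" where
  "lattice_points_dilate L P t = (\<lambda>x. real t *\<^sub>R x) ` P \<inter> L"

definition ehrhart_character ::
    "('g, 'b) monoid_scheme \<Rightarrow> ('g \<Rightarrow> 'a::real_vector \<Rightarrow> 'a) \<Rightarrow> 'a set \<Rightarrow> 'a set \<Rightarrow> nat \<Rightarrow> 'g \<Rightarrow> complex" where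
  "ehrhart_character G \<phi> L P t = character G (permutation_rep \<phi> (lattice_points_dilate L P t))"

end

(*
  The value of chi_{tP} at g is the number of lattice points of tP fixed by g.  If V is the vertex
  set of P, these are the lattice points at height t of the cone generated by the vectors
  sum_{j<N} g^j v for v in V: a fixed point x equals (1/N) sum_{j<N} g^j x, so averaging a
  convex combination of vertices expresses it through these vectors.  The generators are lattice
  points at height N.  A pulling triangulation writes the cone as a disjoint union of half-open
  simplicial cones; translating a fundamental box along its n <= d+1 generators shows that each of
  them has generating function p / (1 - z^N)^n.  The ray through the pulled generator is closed, so
  the box omits the far endpoint in that direction and deg p < N n.
  Hence sum_t chi_{tP} z^t times (1 - z^N)^(d+1) is, at every g, a polynomial of degree below
  N(d+1).  Its coefficients are integer combinations of permutation characters, and every character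
  is a sum of irreducible ones by block triangularisation along an invariant subspace.
*)
theory Submission
  imports Defs "Jordan_Normal_Form.DL_Rank" "HOL-Algebra.Multiplicative_Group"
begin

section \<open>The character ring\<close>

lemma character_ringI:
  assumes "finite S" "S \<subseteq> irreducible_characters G"
    and "\<And>g. a g = (\<Sum>f\<in>S. of_int (c f) * f g)"
  shows "a \<in> character_ring G"
  unfolding character_ring_def using assms by (intro CollectI exI[of _ S] exI[of _ c]) auto

lemma character_ring_0: "(\<lambda>g. 0) \<in> character_ring G"
  by (rule character_ringI[of "{}"]) auto

lemma irreducible_in_character_ring:
  assumes "irreducible_rep G n \<rho>"
  shows "character G \<rho> \<in> character_ring G"
proof (rule character_ringI[of "{character G \<rho>}" _ _ "\<lambda>_. 1"])
  show "{character G \<rho>} \<subseteq> irreducible_characters G"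
    using assms unfolding irreducible_characters_def by auto
qed auto

lemma character_ring_lincomb:
  assumes "a \<in> character_ring G" "b \<in> character_ring G"
  shows "(\<lambda>g. of_int k * a g + of_int l * b g) \<in> character_ring G"
proof -
  obtain S c where S: "finite S" "S \<subseteq> irreducible_characters G"
    "a = (\<lambda>g. \<Sum>f\<in>S. of_int (c f) * f g)"
    using assms(1) unfolding character_ring_def by auto
  obtain T e where T: "finite T" "T \<subseteq> irreducible_characters G"
    "b = (\<lambda>g. \<Sum>f\<in>T. of_int (e f) * f g)"
    using assms(2) unfolding character_ring_def by auto
  \<comment> \<open>Both combinations are extended by zero coefficients to the common support
    \<open>S \<union> T\<close>, where they can be added termwise.\<close>
  have a: "a g = (\<Sum>f\<in>S \<union> T. of_int (if f \<in> S then c f else 0) * f g)" for g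
    unfolding S(3) using S(1,2) T(1,2) by (intro sum.mono_neutral_cong_left) auto
  have b: "b g = (\<Sum>f\<in>S \<union> T. of_int (if f \<in> T then e f else 0) * f g)" for g
    unfolding T(3) using S(1,2) T(1,2) by (intro sum.mono_neutral_cong_left) auto
  show ?thesis
  proof (rule character_ringI)
    show "of_int k * a g + of_int l * b g =
      (\<Sum>f\<in>S \<union> T. of_int (k * (if f \<in> S then c f else 0) + l * (if f \<in> T then e f else 0)) * f g)" for g
      unfolding a b sum_distrib_left sum.distrib[symmetric]
      by (intro sum.cong) (auto simp: algebra_simps)
  qed (use S T in auto)
qed

lemma character_ring_add:
  assumes "a \<in> character_ring G" "b \<in> character_ring G"
  shows "(\<lambda>g. a g + b g) \<in> character_ring G"
  using character_ring_lincomb[OF assms, of 1 1] by simp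

lemma character_ring_diff:
  assumes "a \<in> character_ring G" "b \<in> character_ring G"
  shows "(\<lambda>g. a g - b g) \<in> character_ring G"
  using character_ring_lincomb[OF assms, of 1 "-1"] by simp

lemma character_ring_subset_rational: "character_ring G \<subseteq> rational_character_ring G"
proof
  fix a assume "a \<in> character_ring G"
  then show "a \<in> rational_character_ring G"
    unfolding rational_character_ring_def
    by (intro CollectI exI[of _ "{a}"] exI[of _ "\<lambda>_. 1"]) auto
qed

section \<open>Block triangularisation along an invariant subspace\<close>

lemma maximalD:
  assumes "maximal A P"
  shows "P A" and "\<And>B. A \<subseteq> B \<Longrightarrow> P B \<Longrightarrow> B = A"
  using assms unfolding maximal_def by auto

text \<open>The columns of \<open>P\<close> are a basis of \<open>W\<close> followed by vectors
  completing it to a basis of the whole space, and \<open>Q\<close>, the inverse of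
  \<open>P\<close>, reads off coordinates; a vector of \<open>W\<close> has none beyond the first
  \<open>k\<close>. The bounds on \<open>k\<close> are strict because \<open>W\<close> is neither
  zero nor everything.\<close>

lemma subspace_adapted_basis:
  fixes W :: "complex Matrix.vec set"
  assumes W: "W \<subseteq> carrier_vec n" "0\<^sub>v n \<in> W" "\<And>v w. v \<in> W \<Longrightarrow> w \<in> W \<Longrightarrow> v + w \<in> W"
    "\<And>a v. v \<in> W \<Longrightarrow> a \<cdot>\<^sub>v v \<in> W"
    and proper: "W \<noteq> {0\<^sub>v n}" "W \<noteq> carrier_vec n"
  obtains k P Q where "0 < k" "k < n" "P \<in> carrier_mat n n" "Q \<in> carrier_mat n n"
    "P * Q = 1\<^sub>m n" "Q * P = 1\<^sub>m n" "\<And>j. j < k \<Longrightarrow> col P j \<in> W"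
    "\<And>w i. w \<in> W \<Longrightarrow> k \<le> i \<Longrightarrow> i < n \<Longrightarrow> (Q *\<^sub>v w) $ i = 0"
proof -
  interpret vec_space "TYPE(complex)" n .
  have bound: "finite S \<and> card S \<le> n" if "S \<subseteq> carrier_vec n" "lin_indpt S" for S
    using li_le_dim[OF fin_dim, of S] that dim_is_n by auto
  have li0: "lin_indpt {}" by (auto simp: lin_dep_def)
  \<comment> \<open>Independent sets have at most \<open>n\<close> elements, so a maximal one inside
    \<open>W\<close> exists; it spans \<open>W\<close>. The same argument, started from
    \<open>B\<close>, completes it to a basis \<open>B'\<close>.\<close>
  have "\<exists>B. finite B \<and> maximal B (\<lambda>S. S \<subseteq> W \<and> lin_indpt S)"
    by (rule maximal_exists[where N = n and B = "{}"]) (use bound W(1) li0 in auto)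
  then obtain B where B: "finite B" "maximal B (\<lambda>S. S \<subseteq> W \<and> lin_indpt S)" by auto
  have Bsub: "B \<subseteq> W" "lin_indpt B" using maximalD(1)[OF B(2)] by simp_all
  have Bc: "B \<subseteq> carrier_vec n" using Bsub W by auto
  have "\<exists>B'. finite B' \<and> maximal B' (\<lambda>S. (B \<subseteq> S \<and> S \<subseteq> carrier_vec n) \<and> lin_indpt S)"
    by (rule maximal_exists[where N = n and B = B]) (use bound Bc Bsub in auto)
  then obtain B' where B': "finite B'" "maximal B' (\<lambda>S. (B \<subseteq> S \<and> S \<subseteq> carrier_vec n) \<and> lin_indpt S)"
    by auto
  have B'sub: "B \<subseteq> B'" "B' \<subseteq> carrier_vec n" "lin_indpt B'" using maximalD(1)[OF B'(2)] by simp_all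
  have "maximal B' (\<lambda>S. S \<subseteq> carrier_vec n \<and> lin_indpt S)"
    using B'(2) B'sub(1) unfolding maximal_def by (meson order_trans)
  then have "basis B'" by (intro max_li_is_basis) simp
  then have cardB': "card B' = n" using dim_basis[OF B'(1)] dim_is_n by simp
  have WB: "W \<subseteq> span B"
  proof
    fix w assume w: "w \<in> W"
    show "w \<in> span B"
    proof (rule ccontr)
      assume nin: "w \<notin> span B"
      then have "w \<notin> B" using in_own_span[of B] Bc by auto
      then have "lin_indpt (B \<union> {w})"
        using lin_dep_iff_in_span[of B w] Bc Bsub(2) nin w W(1) by auto
      then have "B \<union> {w} = B" using maximalD(2)[OF B(2), of "B \<union> {w}"] w Bsub by blast
      then show False using \<open>w \<notin> B\<close> by blast
    qed
  qed
  have BW: "span B \<subseteq> W"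
  proof
    fix w assume "w \<in> span B"
    then obtain a where a: "lincomb a B = w"
      using finite_in_span[OF B(1) Bc] by blast
    have "lincomb a S \<in> W" if "S \<subseteq> B" "finite S" for S
      using that(2,1)
    proof (induction S)
      case empty then show ?case using W(2) by (simp add: lincomb_def)
    next
      case (insert x F)
      have "lincomb a (insert x F) = a x \<cdot>\<^sub>v x + lincomb a F"
        using insert Bc by (intro lincomb_insert2) auto
      then show ?case using insert W(3,4) Bsub(1) by auto
    qed
    then show "w \<in> W" using a B(1) by auto
  qed
  have spB: "span B = W" using WB BW by auto
  obtain bs where bs: "set bs = B" "distinct bs" using finite_distinct_list[OF B(1)] by auto
  obtain cs where cs: "set cs = B' - B" "distinct cs"
    using finite_distinct_list[of "B' - B"] B'(1) by auto
  define P where "P = mat_of_cols n (bs @ cs)"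
  have dist: "distinct (bs @ cs)" and set: "set (bs @ cs) = B'" using bs cs B'sub by auto
  have len: "length (bs @ cs) = n" using dist set cardB' distinct_card by metis
  have P: "P \<in> carrier_mat n n" unfolding P_def using len by auto
  have cols: "cols P = bs @ cs" unfolding P_def using B'sub set by (intro cols_mat_of_cols) auto
  have "rank P = n" using lin_indpt_full_rank[OF P] cols dist set B'sub by simp
  then have "det P \<noteq> 0" using det_rank_iff[OF P] by simp
  then obtain Q where Q: "Q \<in> carrier_mat n n" "P * Q = 1\<^sub>m n" "Q * P = 1\<^sub>m n"
    using det_non_zero_imp_unit[OF P] unfolding Units_def ring_mat_def by auto
  have colP: "col P j = (bs @ cs) ! j" if "j < n" for j
    using cols_nth[of j P] cols P that by simp
  have lbs: "length bs \<le> n" using len unfolding length_append by linarith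
  have lcs: "i - length bs < length cs" if "length bs \<le> i" "i < n" for i
    using that len unfolding length_append by linarith
  show ?thesis
  proof (rule that[of "length bs" P Q])
    have "B \<noteq> {}"
    proof
      assume "B = {}"
      then have "span B = {0\<^sub>v n}" by (simp add: span_empty)
      then show False using spB proper by auto
    qed
    then show "0 < length bs" using bs by auto
    have "B \<noteq> B'" using \<open>basis B'\<close> spB proper unfolding basis_def by auto
    then have "cs \<noteq> []" using cs B'sub by auto
    then show "length bs < n" using len by (cases cs) auto
    show "P \<in> carrier_mat n n" "Q \<in> carrier_mat n n" "P * Q = 1\<^sub>m n" "Q * P = 1\<^sub>m n" by fact+
    show "col P j \<in> W" if "j < length bs" for j
    proof -
      have "col P j = bs ! j" 
        unfolding colP[OF less_le_trans[OF that lbs]] by (rule nth_append_left[OF that])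
      then show ?thesis using nth_mem[OF that] bs(1) Bsub(1) by auto
    qed
    show "(Q *\<^sub>v w) $ i = 0" if "w \<in> W" "length bs \<le> i" "i < n" for w i
    proof -
      have "w \<in> span B" using that WB by auto
      then obtain a where "lincomb a B = w"
        using finite_in_span[OF B(1) Bc] by blast
      then have a: "w = lincomb a B" by simp
      define a' where "a' v = (if v \<in> B then a v else 0)" for v
      have "w = lincomb a' B'"
      proof (rule eq_vecI)
        fix j assume "j < dim_vec (lincomb a' B')"
        then have j: "j < n" using lincomb_dim[OF B'(1) B'sub(2)] by auto
        show "w $ j = lincomb a' B' $ j"
          unfolding a lincomb_index[OF j Bc] lincomb_index[OF j B'sub(2)]
          using B'sub B' by (intro sum.mono_neutral_cong_left) (auto simp: a'_def)
      next
        show "dim_vec w = dim_vec (lincomb a' B')"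
          unfolding a lincomb_dim[OF B(1) Bc] lincomb_dim[OF B'(1) B'sub(2)] ..
      qed
      also have "lincomb a' B' = P *\<^sub>v vec n (\<lambda>i. a' (col P i))"
        using mat_mult_eq_lincomb[OF P, of a'] unfolding cols set using dist by metis
      finally have w: "w = P *\<^sub>v vec n (\<lambda>i. a' (col P i))" .
      have "Q *\<^sub>v w = (Q * P) *\<^sub>v vec n (\<lambda>i. a' (col P i))"
        unfolding w by (rule assoc_mult_mat_vec[OF Q(1) P vec_carrier, symmetric])
      also have "\<dots> = vec n (\<lambda>i. a' (col P i))"
        unfolding Q(3) by (rule one_mult_mat_vec[OF vec_carrier])
      finally have Qw: "(Q *\<^sub>v w) $ i = a' (col P i)" by (simp only: index_vec[OF that(3)])
      have colPi: "col P i = cs ! (i - length bs)"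
        unfolding colP[OF that(3)] by (rule nth_append_right[OF that(2)])
      have "cs ! (i - length bs) \<in> B' - B"
        using nth_mem[OF lcs[OF that(2,3)]] unfolding cs(1) .
      then show ?thesis unfolding Qw colPi a'_def by simp
    qed
  qed
qed

lemma index_mult_mat_sum:
  assumes "A \<in> carrier_mat n m" "B \<in> carrier_mat m p" "i < n" "j < p"
  shows "(A * B) $$ (i, j) = (\<Sum>l<m. A $$ (i, l) * B $$ (l, j))"
proof -
  have "(A * B) $$ (i, j) = Matrix.row A i \<bullet> col B j" using assms by (intro index_mult_mat) auto
  also have "\<dots> = (\<Sum>l<m. A $$ (i, l) * B $$ (l, j))"
    unfolding scalar_prod_def using assms by (intro sum.cong) auto
  finally show ?thesis .
qed

text \<open>When the lower left block vanishes, the diagonal blocks of a product are the products of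
  the diagonal blocks, and the trace is the sum of the two block traces. The upper right block is
  arbitrary: it never meets a diagonal block of a product except through a zero factor.\<close>

lemma matrix_rep_diagonal_block:
  assumes R: "matrix_rep G n R" and G: "monoid G" and kn: "k \<le> n"
    and zero: "\<And>g i j. g \<in> carrier G \<Longrightarrow> j < k \<Longrightarrow> k \<le> i \<Longrightarrow> i < n \<Longrightarrow> R g $$ (i, j) = 0"
  obtains A D where "matrix_rep G k A" "matrix_rep G (n - k) D"
    "character G R = (\<lambda>g. character G A g + character G D g)"
proof
  define A where "A g = Matrix.mat k k (\<lambda>(i, j). R g $$ (i, j))" for g
  define D where "D g = Matrix.mat (n - k) (n - k) (\<lambda>(i, j). R g $$ (i + k, j + k))" for g
  have Rc: "R g \<in> carrier_mat n n" if "g \<in> carrier G" for g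
    using R that unfolding matrix_rep_def by blast
  have R1: "R \<one>\<^bsub>G\<^esub> = 1\<^sub>m n" using R unfolding matrix_rep_def by blast
  have Rm: "R (g \<otimes>\<^bsub>G\<^esub> h) $$ (i, j) = (\<Sum>l<n. R g $$ (i, l) * R h $$ (l, j))"
    if "g \<in> carrier G" "h \<in> carrier G" "i < n" "j < n" for g h i j
  proof -
    have "R (g \<otimes>\<^bsub>G\<^esub> h) = R g * R h" using R that(1,2) unfolding matrix_rep_def by blast
    then show ?thesis using index_mult_mat_sum[OF Rc[OF that(1)] Rc[OF that(2)] that(3,4)] by simp
  qed
  have split: "{..<n} = {..<k} \<union> {k..<n}" "{..<k} \<inter> {k..<n} = {}" using kn by auto
  have shift: "(\<Sum>l\<in>{k..<n}. f l) = (\<Sum>l<n - k. f (l + k))" for f :: "nat \<Rightarrow> complex"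
    by (rule sum.reindex_bij_witness[of _ "\<lambda>l. l + k" "\<lambda>l. l - k"]) auto
  have sum_split: "(\<Sum>l<n. f l) = (\<Sum>l<k. f l) + (\<Sum>l<n - k. f (l + k))" for f :: "nat \<Rightarrow> complex"
    unfolding split(1) shift[symmetric] by (rule sum.union_disjoint) (use split(2) in auto)
  show "matrix_rep G k A"
    unfolding matrix_rep_def
  proof (intro conjI ballI)
    fix g h assume gh: "g \<in> carrier G" "h \<in> carrier G"
    show "A (g \<otimes>\<^bsub>G\<^esub> h) = A g * A h"
    proof (rule eq_matI)
      fix i j assume "i < dim_row (A g * A h)" "j < dim_col (A g * A h)"
      then have ij: "i < k" "j < k" by (auto simp: A_def)
      have "A (g \<otimes>\<^bsub>G\<^esub> h) $$ (i, j) = (\<Sum>l<n. R g $$ (i, l) * R h $$ (l, j))"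
        using ij kn Rm[OF gh] by (simp add: A_def)
      also have "\<dots> = (\<Sum>l<k. R g $$ (i, l) * R h $$ (l, j))"
        unfolding sum_split using zero[OF gh(2) ij(2)] by simp
      also have "\<dots> = (A g * A h) $$ (i, j)"
        using ij by (subst index_mult_mat_sum[of _ k k _ k]) (auto simp: A_def)
      finally show "A (g \<otimes>\<^bsub>G\<^esub> h) $$ (i, j) = (A g * A h) $$ (i, j)" .
    qed (auto simp: A_def)
  qed (use kn R1 in \<open>auto simp: A_def\<close>)
  show "matrix_rep G (n - k) D"
    unfolding matrix_rep_def
  proof (intro conjI ballI)
    fix g h assume gh: "g \<in> carrier G" "h \<in> carrier G"
    show "D (g \<otimes>\<^bsub>G\<^esub> h) = D g * D h"
    proof (rule eq_matI)
      fix i j assume "i < dim_row (D g * D h)" "j < dim_col (D g * D h)"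
      then have ij: "i < n - k" "j < n - k" by (auto simp: D_def)
      have "D (g \<otimes>\<^bsub>G\<^esub> h) $$ (i, j) = (\<Sum>l<n. R g $$ (i + k, l) * R h $$ (l, j + k))"
        using ij kn Rm[OF gh] by (simp add: D_def)
      also have "\<dots> = (\<Sum>l<n - k. R g $$ (i + k, l + k) * R h $$ (l + k, j + k))"
        unfolding sum_split using zero[OF gh(1), of _ "i + k"] ij by simp
      also have "\<dots> = (D g * D h) $$ (i, j)"
        using ij by (subst index_mult_mat_sum[of _ "n - k" "n - k" _ "n - k"]) (auto simp: D_def)
      finally show "D (g \<otimes>\<^bsub>G\<^esub> h) $$ (i, j) = (D g * D h) $$ (i, j)" .
    qed (auto simp: D_def)
  qed (use kn R1 in \<open>auto simp: D_def\<close>)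
  show "character G R = (\<lambda>g. character G A g + character G D g)"
  proof
    fix g
    show "character G R g = character G A g + character G D g"
    proof (cases "g \<in> carrier G")
      case True
      then have "dim_row (R g) = n" using Rc by auto
      then show ?thesis using True sum_split[of "\<lambda>i. R g $$ (i, i)"]
        by (simp add: character_def A_def D_def)
    qed (simp add: character_def)
  qed
qed

text \<open>Multiplicativity comes from inserting \<open>P * Q = 1\<close> between the two factors,
  and equality of characters from the cyclic invariance of the trace.\<close>

lemma matrix_rep_conjugate:
  assumes R: "matrix_rep G n R" and G: "monoid G"
    and P: "P \<in> carrier_mat n n" and Q: "Q \<in> carrier_mat n n"
    and PQ: "P * Q = 1\<^sub>m n" and QP: "Q * P = 1\<^sub>m n"
  shows "matrix_rep G n (\<lambda>g. Q * R g * P)" "character G (\<lambda>g. Q * R g * P) = character G R"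
proof -
  have Rc: "R g \<in> carrier_mat n n" if "g \<in> carrier G" for g
    using R that unfolding matrix_rep_def by blast
  have mult: "Q * (A * B) * P = (Q * A * P) * (Q * B * P)"
    if A: "A \<in> carrier_mat n n" and B: "B \<in> carrier_mat n n" for A B
  proof -
    have "(Q * A * P) * (Q * B * P) = Q * A * (P * (Q * B * P))"
      using P Q A B by (intro assoc_mult_mat) auto
    also have "P * (Q * B * P) = (P * (Q * B)) * P"
      using P Q B by (intro assoc_mult_mat[symmetric]) auto
    also have "P * (Q * B) = (P * Q) * B"
      using P Q B by (intro assoc_mult_mat[symmetric]) auto
    also have "\<dots> = B" unfolding PQ using B by auto
    also have "Q * A * (B * P) = Q * A * B * P"
      using P Q A B by (intro assoc_mult_mat[symmetric]) auto
    also have "Q * A * B = Q * (A * B)"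
      using Q A B by (intro assoc_mult_mat) auto
    finally show ?thesis by simp
  qed
  show "matrix_rep G n (\<lambda>g. Q * R g * P)"
    unfolding matrix_rep_def
  proof (intro conjI ballI)
    show "Q * R \<one>\<^bsub>G\<^esub> * P = 1\<^sub>m n" using R P Q QP unfolding matrix_rep_def by auto
    show "Q * R g * P \<in> carrier_mat n n" if "g \<in> carrier G" for g using P Q Rc[OF that] by auto
    show "Q * R (g \<otimes>\<^bsub>G\<^esub> h) * P = Q * R g * P * (Q * R h * P)"
      if "g \<in> carrier G" "h \<in> carrier G" for g h
    proof -
      have "R (g \<otimes>\<^bsub>G\<^esub> h) = R g * R h" using R that unfolding matrix_rep_def by blast
      then show ?thesis using mult[OF Rc[OF that(1)] Rc[OF that(2)]] by simp
    qed
  qed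
  have "(\<Sum>i<n. (Q * A * P) $$ (i, i)) = (\<Sum>i<n. A $$ (i, i))" if A: "A \<in> carrier_mat n n" for A
  proof -
    have QA: "Q * A \<in> carrier_mat n n" using Q A by auto
    have "(\<Sum>i<n. (Q * A * P) $$ (i, i)) = (\<Sum>i<n. \<Sum>l<n. (Q * A) $$ (i, l) * P $$ (l, i))"
      using index_mult_mat_sum[OF QA P] by simp
    also have "\<dots> = (\<Sum>l<n. \<Sum>i<n. P $$ (l, i) * (Q * A) $$ (i, l))"
      by (subst sum.swap) (simp add: mult.commute)
    also have "\<dots> = (\<Sum>l<n. (P * (Q * A)) $$ (l, l))"
      using index_mult_mat_sum[OF P QA] by simp
    also have "P * (Q * A) = (P * Q) * A"
      using P Q A by (intro assoc_mult_mat[symmetric]) auto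
    also have "\<dots> = A" unfolding PQ using A by auto
    finally show ?thesis .
  qed
  then show "character G (\<lambda>g. Q * R g * P) = character G R"
    unfolding character_def using Rc Q by (intro ext) auto
qed

text \<open>Strong induction on the degree. A reducible representation is conjugated into block
  triangular form along an invariant subspace, and both diagonal blocks have smaller degree. Degree
  0, which is not irreducible by definition, contributes the zero function.\<close>

lemma character_in_character_ring:
  assumes G: "monoid G" and R: "matrix_rep G n R"
  shows "character G R \<in> character_ring G"
  using R
proof (induction n arbitrary: R rule: less_induct)
  case (less n)
  have Rc: "R g \<in> carrier_mat n n" if "g \<in> carrier G" for g
    using less.prems that unfolding matrix_rep_def by blast
  consider "n = 0" | "irreducible_rep G n R"
    | W where "invariant_subspace G n R W" "W \<noteq> {0\<^sub>v n}" "W \<noteq> carrier_vec n"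
    using less.prems unfolding irreducible_rep_def by blast
  then show ?case
  proof cases
    case 1
    have "character G R = (\<lambda>g. 0)"
      unfolding character_def using carrier_matD(1)[OF Rc] 1 by (intro ext) auto
    then show ?thesis by (simp add: character_ring_0)
  next
    case 2
    then show ?thesis by (rule irreducible_in_character_ring)
  next
    case 3
    have inv: "R g *\<^sub>v v \<in> W" if "g \<in> carrier G" "v \<in> W" for g v
      using 3(1) that unfolding invariant_subspace_def by blast
    have W: "W \<subseteq> carrier_vec n" "0\<^sub>v n \<in> W" "\<And>v w. v \<in> W \<Longrightarrow> w \<in> W \<Longrightarrow> v + w \<in> W"
      "\<And>a v. v \<in> W \<Longrightarrow> a \<cdot>\<^sub>v v \<in> W"
      using 3(1) unfolding invariant_subspace_def by blast+
    obtain k P Q where k: "0 < k" "k < n" and P: "P \<in> carrier_mat n n" and Q: "Q \<in> carrier_mat n n"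
      and PQ: "P * Q = 1\<^sub>m n" "Q * P = 1\<^sub>m n" and colW: "\<And>j. j < k \<Longrightarrow> col P j \<in> W"
      and Qw: "\<And>w i. w \<in> W \<Longrightarrow> k \<le> i \<Longrightarrow> i < n \<Longrightarrow> (Q *\<^sub>v w) $ i = 0"
      using subspace_adapted_basis[OF W 3(2,3)] by blast
    let ?S = "\<lambda>g. Q * R g * P"
    note S = matrix_rep_conjugate[OF less.prems G P Q PQ]
    \<comment> \<open>Column \<open>j\<close> of \<open>P\<close> lies in \<open>W\<close>, so
      \<open>R g\<close> maps it into \<open>W\<close>, where \<open>Q\<close> gives zero in all
      rows from \<open>k\<close> on.\<close>
    have zero: "?S g $$ (i, j) = 0" if g: "g \<in> carrier G" and ij: "j < k" "k \<le> i" "i < n" for g i j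
    proof -
      have "?S g = Q * (R g * P)" using Q P Rc[OF g] by (intro assoc_mult_mat) auto
      then have "?S g $$ (i, j) = Matrix.row Q i \<bullet> (R g *\<^sub>v col P j)"
        using Q P Rc[OF g] ij k by (simp add: col_mult2[of _ n n _ n])
      also have "\<dots> = (Q *\<^sub>v (R g *\<^sub>v col P j)) $ i"
        using Q ij by simp
      also have "\<dots> = 0" using Qw inv colW g ij by blast
      finally show ?thesis .
    qed
    obtain A D where blocks: "matrix_rep G k A" "matrix_rep G (n - k) D"
      "character G ?S = (\<lambda>g. character G A g + character G D g)"
      by (rule matrix_rep_diagonal_block[OF S(1) G less_imp_le[OF k(2)] zero])
    have nk: "n - k < n" using k by simp
    have "character G ?S \<in> character_ring G"
      unfolding blocks(3)
      by (rule character_ring_add[OF less.IH[OF k(2) blocks(1)] less.IH[OF nk blocks(2)]])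
    then show ?thesis unfolding S(2) .
  qed
qed

section \<open>Permutation representations and their traces\<close>

lemma permutation_rep_matrix_rep:
  assumes G: "group_action G UNIV \<phi>" and X: "finite X"
    and inv: "\<And>g x. g \<in> carrier G \<Longrightarrow> x \<in> X \<Longrightarrow> \<phi> g x \<in> X"
  shows "matrix_rep G (card X) (permutation_rep \<phi> X)"
proof -
  interpret group_action G UNIV \<phi> by fact
  let ?x = "from_nat_into X"
  have bij: "bij_betw ?x {..<card X} X" using bij_betw_from_nat_into_finite[OF X] .
  have "permutation_rep \<phi> X (g \<otimes>\<^bsub>G\<^esub> h) = permutation_rep \<phi> X g * permutation_rep \<phi> X h"
    if gh: "g \<in> carrier G" "h \<in> carrier G" for g h
  proof (rule eq_matI)
    fix i j assume "i < dim_row (permutation_rep \<phi> X g * permutation_rep \<phi> X h)"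
      "j < dim_col (permutation_rep \<phi> X g * permutation_rep \<phi> X h)"
    then have ij: "i < card X" "j < card X" by (auto simp: permutation_rep_def)
    have "?x j \<in> X" using bij_betwE[OF bij] ij(2) by blast
    \<comment> \<open>Invariance of \<open>X\<close> yields the index \<open>m\<close> of the image
      point. It is the only row in which column \<open>j\<close> of the matrix of \<open>h\<close>
      is nonzero, so the sum for the product collapses to one term.\<close>
    then have "\<phi> h (?x j) \<in> ?x ` {..<card X}"
      unfolding bij_betw_imp_surj_on[OF bij] using inv gh(2) by blast
    then obtain m where m: "m < card X" "\<phi> h (?x j) = ?x m" by blast
    have eq: "?x m = ?x l \<longleftrightarrow> l = m" if "l < card X" for l
      using inj_on_eq_iff[OF bij_betw_imp_inj_on[OF bij], of m l] that m(1) by blast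
    have "(permutation_rep \<phi> X g * permutation_rep \<phi> X h) $$ (i, j) =
       (\<Sum>l<card X. (if \<phi> g (?x l) = ?x i then 1 else 0) * (if \<phi> h (?x j) = ?x l then 1 else 0))"
      using ij by (subst index_mult_mat_sum[of _ "card X" "card X" _ "card X"]) (auto simp: permutation_rep_def)
    also have "\<dots> = (\<Sum>l<card X. if l = m then (if \<phi> g (?x l) = ?x i then 1 else 0) else 0)"
      unfolding m(2) using eq by (intro sum.cong refl) simp
    also have "\<dots> = (if \<phi> g (\<phi> h (?x j)) = ?x i then 1 else 0)" using m by simp
    also have "\<phi> g (\<phi> h (?x j)) = \<phi> (g \<otimes>\<^bsub>G\<^esub> h) (?x j)" using composition_rule[of "?x j" g h] gh by simp
    finally show "permutation_rep \<phi> X (g \<otimes>\<^bsub>G\<^esub> h) $$ (i, j) =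
        (permutation_rep \<phi> X g * permutation_rep \<phi> X h) $$ (i, j)"
      using ij by (simp add: permutation_rep_def)
  qed (auto simp: permutation_rep_def)
  moreover have "permutation_rep \<phi> X \<one>\<^bsub>G\<^esub> = 1\<^sub>m (card X)"
  proof (rule eq_matI)
    fix i j assume "i < dim_row (1\<^sub>m (card X))" "j < dim_col (1\<^sub>m (card X))"
    then have ij: "i < card X" "j < card X" by simp_all
    have "\<phi> \<one>\<^bsub>G\<^esub> (?x j) = ?x j" unfolding id_eq_one[symmetric] by simp
    moreover have "?x j = ?x i \<longleftrightarrow> i = j"
      using inj_on_eq_iff[OF bij_betw_imp_inj_on[OF bij], of j i] ij by blast
    ultimately show "permutation_rep \<phi> X \<one>\<^bsub>G\<^esub> $$ (i, j) = 1\<^sub>m (card X) $$ (i, j)"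
      using ij by (simp add: permutation_rep_def)
  qed (auto simp: permutation_rep_def)
  ultimately show ?thesis
    unfolding matrix_rep_def by (auto simp: permutation_rep_def)
qed

lemma character_permutation_rep:
  assumes X: "finite X" and g: "g \<in> carrier G"
  shows "character G (permutation_rep \<phi> X) g = of_nat (card {x \<in> X. \<phi> g x = x})"
proof -
  let ?x = "from_nat_into X"
  have bij: "bij_betw ?x {..<card X} X" using bij_betw_from_nat_into_finite[OF X] .
  have "character G (permutation_rep \<phi> X) g = (\<Sum>i<card X. if \<phi> g (?x i) = ?x i then 1 else 0)"
    using g by (simp add: character_def permutation_rep_def)
  also have "\<dots> = (\<Sum>x\<in>X. if \<phi> g x = x then 1 else 0)"
    using sum.reindex_bij_betw[OF bij, of "\<lambda>x. if \<phi> g x = x then 1 else (0::complex)"] .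
  also have "\<dots> = of_nat (card {x \<in> X. \<phi> g x = x})"
    using X by (simp add: sum.If_cases Int_def)
  finally show ?thesis .
qed

section \<open>Generating functions of half-open cones\<close>

lemma fps_nth_mult_one_minus_X_power:
  fixes f :: "'a::comm_ring_1 fps"
  shows "fps_nth (f * (1 - fps_X ^ N)) k = fps_nth f k - (if N \<le> k then fps_nth f (k - N) else 0)"
  by (simp add: algebra_simps fps_X_power_mult_right_nth)

text \<open>
  Equivalently, the coefficients form a quasi-polynomial with period dividing \<open>N\<close> and degree below
  \<open>n\<close> that is valid from index 0 on.
\<close>

definition quasi_poly_fps :: "nat \<Rightarrow> nat \<Rightarrow> 'a::comm_ring_1 fps \<Rightarrow> bool" where
  "quasi_poly_fps N n f \<longleftrightarrow> (\<forall>k\<ge>N * n. fps_nth (f * (1 - fps_X ^ N) ^ n) k = 0)"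

text \<open>For \<open>k\<close> at least \<open>N * Suc n\<close>, both \<open>k\<close> and
  \<open>k - N\<close> are at least \<open>N * n\<close>, so the new coefficient is a difference of
  two vanishing ones.\<close>

lemma quasi_poly_fps_Suc:
  assumes "quasi_poly_fps N n f"
  shows "quasi_poly_fps N (Suc n) f"
  unfolding quasi_poly_fps_def
proof (intro allI impI)
  fix k assume k: "N * Suc n \<le> k"
  have "f * (1 - fps_X ^ N) ^ Suc n = f * (1 - fps_X ^ N) ^ n * (1 - fps_X ^ N)"
    by (simp add: mult.assoc mult.commute)
  then show "fps_nth (f * (1 - fps_X ^ N) ^ Suc n) k = 0"
    using assms k unfolding quasi_poly_fps_def by (auto simp only: fps_nth_mult_one_minus_X_power) auto
qed

lemma quasi_poly_fps_mono:
  assumes "quasi_poly_fps N n f" "n \<le> m"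
  shows "quasi_poly_fps N m f"
  using assms(2,1) by (induction rule: dec_induct) (auto intro: quasi_poly_fps_Suc)

lemma quasi_poly_fps_sum:
  assumes "\<And>i. i \<in> I \<Longrightarrow> quasi_poly_fps N n (f i)"
  shows "quasi_poly_fps N n (\<Sum>i\<in>I. f i)"
  using assms unfolding quasi_poly_fps_def by (simp add: sum_distrib_right fps_sum_nth)

text \<open>The Hilbert series of \<open>E\<close> graded by \<open>h\<close>. An infinite slice
  would count as 0, hence the finiteness assumptions wherever counts are added.\<close>

definition slice_fps :: "('a \<Rightarrow> real) \<Rightarrow> 'a set \<Rightarrow> complex fps" where
  "slice_fps h E = Abs_fps (\<lambda>t. of_nat (card {x \<in> E. h x = real t}))"

text \<open>The slice of \<open>E\<close> at height \<open>t\<close> splits into that of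
  \<open>E0\<close> and a translate of the slice of \<open>E\<close> at height \<open>t - N\<close>.
  Since heights in \<open>E\<close> are nonnegative, the second part is empty for
  \<open>t < N\<close>, matching the coefficient rule for \<open>1 - fps_X ^ N\<close>.\<close>

lemma slice_fps_translate:
  fixes h :: "'a::real_vector \<Rightarrow> real"
  assumes h: "linear h" and ha: "h a = real N"
    and fin: "\<And>t. finite {x \<in> E. h x = real t}" and nonneg: "\<And>x. x \<in> E \<Longrightarrow> 0 \<le> h x"
    and E: "E = E0 \<union> (\<lambda>x. x + a) ` E" and disj: "E0 \<inter> (\<lambda>x. x + a) ` E = {}"
  shows "slice_fps h E * (1 - fps_X ^ N) = slice_fps h E0"
proof (rule fps_ext)
  fix t
  have hadd: "h (x + a) = h x + real N" for x using linear_add[OF h] ha by simp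
  define T where "T = {x \<in> (\<lambda>x. x + a) ` E. h x = real t}"
  have split: "{x \<in> E. h x = real t} = {x \<in> E0. h x = real t} \<union> T"
    unfolding T_def by (subst E) blast
  have "finite T" "finite {x \<in> E0. h x = real t}" using fin[of t] unfolding split by auto
  then have card: "card {x \<in> E. h x = real t} = card {x \<in> E0. h x = real t} + card T"
    unfolding split by (intro card_Un_disjoint) (use disj in \<open>auto simp: T_def\<close>)
  have "card T = (if N \<le> t then card {x \<in> E. h x = real (t - N)} else 0)"
  proof (cases "N \<le> t")
    case True
    have "T = (\<lambda>x. x + a) ` {x \<in> E. h x = real (t - N)}"
      unfolding T_def using True by (auto simp: hadd of_nat_diff)
    then show ?thesis using True by (simp add: card_image inj_on_def)
  next
    case False
    have "T = {}" unfolding T_def using False nonneg by (fastforce simp: hadd)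
    then show ?thesis using False by simp
  qed
  then show "fps_nth (slice_fps h E * (1 - fps_X ^ N)) t = fps_nth (slice_fps h E0) t"
    unfolding fps_nth_mult_one_minus_X_power by (simp add: slice_fps_def card)
qed

lemma slice_fps_UN:
  assumes I: "finite I" and fin: "\<And>t. finite {x \<in> E. h x = real t}" and E: "E = (\<Union>i\<in>I. F i)"
    and disj: "\<And>i j. i \<in> I \<Longrightarrow> j \<in> I \<Longrightarrow> i \<noteq> j \<Longrightarrow> F i \<inter> F j = {}"
  shows "slice_fps h E = (\<Sum>i\<in>I. slice_fps h (F i))"
proof (rule fps_ext)
  fix t
  have split: "{x \<in> E. h x = real t} = (\<Union>i\<in>I. {x \<in> F i. h x = real t})" unfolding E by blast
  have finF: "\<forall>i\<in>I. finite {x \<in> F i. h x = real t}" using fin[of t] I unfolding split by simp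
  have "card {x \<in> E. h x = real t} = (\<Sum>i\<in>I. card {x \<in> F i. h x = real t})"
    unfolding split by (rule card_UN_disjoint[OF I finF]) (use disj in blast)
  then show "fps_nth (slice_fps h E) t = fps_nth (\<Sum>i\<in>I. slice_fps h (F i)) t"
    by (simp add: slice_fps_def fps_sum_nth)
qed

section \<open>Half-open simplicial cones\<close>

definition open_cone :: "'a::real_vector set \<Rightarrow> 'a set" where
  "open_cone S = {(\<Sum>v\<in>S. u v *\<^sub>R v) | u. \<forall>v\<in>S. 0 < u v}"

definition half_open_cone :: "'a::real_vector \<Rightarrow> 'a set \<Rightarrow> 'a set" where
  "half_open_cone v S = {s *\<^sub>R v + y | s y. 0 \<le> s \<and> y \<in> open_cone S}"

lemma independent_sum_unique:
  assumes "independent A" "finite A" "(\<Sum>a\<in>A. u a *\<^sub>R a) = (\<Sum>a\<in>A. w a *\<^sub>R a)" "a \<in> A"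
  shows "u a = w a"
proof -
  have "(\<Sum>a\<in>A. (u a - w a) *\<^sub>R a) = 0" using assms(3) by (simp add: algebra_simps sum_subtractf)
  then show ?thesis using independentD[OF assms(1,2) subset_refl _ assms(4), of "\<lambda>a. u a - w a"] by simp
qed

text \<open>Restricting one coordinate from a ray to a unit interval removes all translates by that
  generator and costs one factor \<open>1 - fps_X ^ N\<close>. After all generators have been
  treated a bounded box remains, with every height below
  \<open>N * card (insert v S)\<close>.\<close>

lemma quasi_poly_half_open_cone:
  fixes h :: "'a::real_vector \<Rightarrow> real"
  assumes ind: "independent (insert v S)" and S: "finite S" "v \<notin> S"
    and h: "linear h" and hN: "\<And>a. a \<in> insert v S \<Longrightarrow> h a = real N" and N: "0 < N"
    and L: "\<And>x y. x \<in> L \<Longrightarrow> y \<in> L \<Longrightarrow> x + y \<in> L" "\<And>x y. x \<in> L \<Longrightarrow> y \<in> L \<Longrightarrow> x - y \<in> L"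
    and SL: "insert v S \<subseteq> L"
    and fin: "\<And>t. finite {x \<in> L \<inter> half_open_cone v S. h x = real t}"
  shows "quasi_poly_fps N (card (insert v S)) (slice_fps h (L \<inter> half_open_cone v S))"
proof -
  define A where "A = insert v S"
  have A: "finite A" "independent A" "A \<subseteq> L" "v \<in> A" using S ind SL by (auto simp: A_def)
  \<comment> \<open>Coordinates in \<open>J\<close> range over the full ray, the others over a unit interval.\<close>
  define box where "box J u \<longleftrightarrow> (\<forall>a\<in>S. 0 < u a) \<and> 0 \<le> u v \<and> (\<forall>a\<in>S - J. u a \<le> 1) \<and> (v \<notin> J \<longrightarrow> u v < 1)"
    for J and u :: "'a \<Rightarrow> real"
  define E where "E J = {x \<in> L. \<exists>u. x = (\<Sum>a\<in>A. u a *\<^sub>R a) \<and> box J u}" for J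
  have hsum: "h (\<Sum>a\<in>A. u a *\<^sub>R a) = real N * (\<Sum>a\<in>A. u a)" for u
    using hN unfolding linear_sum[OF h] linear_cmul[OF h] A_def[symmetric]
    by (simp add: sum_distrib_left mult.commute)
  have boxnn: "0 \<le> u a" if "box J u" "a \<in> A" for J u a
    using that unfolding box_def A_def by (auto intro: less_imp_le)
  have EA: "E A = L \<inter> half_open_cone v S"
  proof (intro equalityI subsetI)
    fix x assume "x \<in> E A"
    then obtain u where u: "x \<in> L" "x = (\<Sum>a\<in>A. u a *\<^sub>R a)" "box A u" unfolding E_def by blast
    have "x = u v *\<^sub>R v + (\<Sum>a\<in>S. u a *\<^sub>R a)" using u(2) S unfolding A_def by simp
    then show "x \<in> L \<inter> half_open_cone v S"
      using u(1,3) unfolding half_open_cone_def open_cone_def box_def by blast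
  next
    fix x assume x: "x \<in> L \<inter> half_open_cone v S"
    then obtain s u where u: "x = s *\<^sub>R v + (\<Sum>a\<in>S. u a *\<^sub>R a)" "0 \<le> s" "\<forall>a\<in>S. 0 < u a"
      unfolding half_open_cone_def open_cone_def by blast
    have "x = (\<Sum>a\<in>A. (u(v := s)) a *\<^sub>R a)"
    proof -
      have "(\<Sum>a\<in>S. (u(v := s)) a *\<^sub>R a) = (\<Sum>a\<in>S. u a *\<^sub>R a)"
        by (rule sum.cong) (use S(2) in auto)
      then show ?thesis unfolding u(1) A_def using S by simp
    qed
    moreover have "box A (u(v := s))" using u S(2) unfolding box_def A_def by auto
    ultimately show "x \<in> E A" using x unfolding E_def by blast
  qed
  have Esub: "E J \<subseteq> E A" for J unfolding E_def box_def A_def by blast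
  have Efin: "finite {x \<in> E J. h x = real t}" for J t
    using finite_subset[of "{x \<in> E J. h x = real t}" "{x \<in> E A. h x = real t}"] Esub[of J] fin[of t]
    unfolding EA by blast
  have nonneg: "0 \<le> h x" if x: "x \<in> E J" for x J
  proof -
    obtain u where u: "x = (\<Sum>a\<in>A. u a *\<^sub>R a)" "box J u" using x unfolding E_def by blast
    show ?thesis unfolding u(1) hsum using boxnn[OF u(2)] by (simp add: sum_nonneg)
  qed
  have step: "slice_fps h (E (insert a J)) * (1 - fps_X ^ N) = slice_fps h (E J)"
    if a: "a \<in> A" "a \<notin> J" for a J
  proof (rule slice_fps_translate[OF h _ Efin nonneg])
    show "h a = real N" using hN a by (simp add: A_def)
    have aL: "a \<in> L" using A a by blast
    have upd: "(\<Sum>b\<in>A. (u(a := u a + c)) b *\<^sub>R b) = (\<Sum>b\<in>A. u b *\<^sub>R b) + c *\<^sub>R a" for u c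
    proof -
      have "(\<Sum>b\<in>A. (u(a := u a + c)) b *\<^sub>R b) = (\<Sum>b\<in>A. u b *\<^sub>R b + (if b = a then c *\<^sub>R a else 0))"
        by (intro sum.cong) (auto simp: algebra_simps)
      then show ?thesis using A(1) a by (simp add: sum.distrib)
    qed
    show "E (insert a J) = E J \<union> (\<lambda>x. x + a) ` E (insert a J)"
    proof (intro equalityI subsetI)
      fix x assume "x \<in> E (insert a J)"
      then obtain u where u: "x \<in> L" "x = (\<Sum>a\<in>A. u a *\<^sub>R a)" "box (insert a J) u" unfolding E_def by blast
      show "x \<in> E J \<union> (\<lambda>x. x + a) ` E (insert a J)"
      proof (cases "box J u")
        case True
        then show ?thesis using u unfolding E_def by blast
      next
        case False
        let ?u = "u(a := u a + (-1))"
        \<comment> \<open>The condition for \<open>J\<close> can fail only at \<open>a\<close>. The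
          intervals are left-open for generators in \<open>S\<close> and right-open for
          \<open>v\<close>, so subtracting 1 keeps the lower bound in either case.\<close>
        have ge: "a \<in> S \<and> 1 < u a \<or> a = v \<and> 1 \<le> u a"
          using False u(3) unfolding box_def by force
        have "box (insert a J) ?u"
          using u(3) ge S(2) unfolding box_def by auto
        moreover have "x - a = (\<Sum>b\<in>A. ?u b *\<^sub>R b)" unfolding upd u(2) by simp
        ultimately have "x - a \<in> E (insert a J)" using u(1) aL L(2) unfolding E_def by blast
        then have "(x - a) + a \<in> (\<lambda>x. x + a) ` E (insert a J)" by (rule imageI)
        then show ?thesis by simp
      qed
    next
      fix x assume "x \<in> E J \<union> (\<lambda>x. x + a) ` E (insert a J)"
      then consider "x \<in> E J" | y where "x = y + a" "y \<in> E (insert a J)" by blast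
      then show "x \<in> E (insert a J)"
      proof cases
        case 1
        then show ?thesis unfolding E_def box_def by blast
      next
        case 2
        then obtain u where u: "y \<in> L" "y = (\<Sum>a\<in>A. u a *\<^sub>R a)" "box (insert a J) u" unfolding E_def by blast
        let ?u = "u(a := u a + 1)"
        have "box (insert a J) ?u"
          using u(3) a(1) boxnn[OF u(3) a(1)] S(2) unfolding box_def A_def by auto
        moreover have "x = (\<Sum>b\<in>A. ?u b *\<^sub>R b)" unfolding upd 2(1) u(2) by simp
        moreover have "x \<in> L" using L(1)[OF u(1) aL] 2(1) by simp
        ultimately show ?thesis unfolding E_def by blast
      qed
    qed
    show "E J \<inter> (\<lambda>x. x + a) ` E (insert a J) = {}"
    proof (intro equals0I)
      fix x assume "x \<in> E J \<inter> (\<lambda>x. x + a) ` E (insert a J)"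
      then have x: "x \<in> E J" "x \<in> (\<lambda>x. x + a) ` E (insert a J)" by blast+
      obtain y where y: "x = y + a" "y \<in> E (insert a J)" using x(2) by blast
      obtain u where u: "x = (\<Sum>a\<in>A. u a *\<^sub>R a)" "box J u" using x(1) unfolding E_def by blast
      obtain w where w: "y = (\<Sum>a\<in>A. w a *\<^sub>R a)" "box (insert a J) w"
        using y(2) unfolding E_def by blast
      \<comment> \<open>Coordinates are unique by independence. A shift by 1 cannot end inside a
        half-open unit interval when it starts on the corresponding ray.\<close>
      have "(\<Sum>b\<in>A. u b *\<^sub>R b) = (\<Sum>b\<in>A. (w(a := w a + 1)) b *\<^sub>R b)"
        unfolding upd using u(1) y(1) w(1) by simp
      from independent_sum_unique[OF A(2,1) this a(1)] have "u a = w a + 1" by simp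
      moreover have "a \<in> S \<and> u a \<le> 1 \<and> 0 < w a \<or> a = v \<and> u a < 1 \<and> 0 \<le> w a"
        using u(2) w(2) a unfolding box_def A_def by blast
      ultimately show False by linarith
    qed
  qed
  have "slice_fps h (E J) * (1 - fps_X ^ N) ^ card J = slice_fps h (E {})" if "J \<subseteq> A" for J
    using finite_subset[OF that A(1)] that
  proof (induction J rule: finite_induct)
    case (insert a J)
    have "slice_fps h (E (insert a J)) * (1 - fps_X ^ N) ^ card (insert a J) =
        (slice_fps h (E (insert a J)) * (1 - fps_X ^ N)) * (1 - fps_X ^ N) ^ card J"
      using insert.hyps by (simp add: mult.assoc)
    also have "\<dots> = slice_fps h (E {})" using step[of a J] insert by simp
    finally show ?case .
  qed simp
  then have *: "slice_fps h (E A) * (1 - fps_X ^ N) ^ card A = slice_fps h (E {})" by simp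
  have "{x \<in> E {}. h x = real k} = {}" if k: "N * card A \<le> k" for k
  proof (intro equals0I)
    fix x assume "x \<in> {x \<in> E {}. h x = real k}"
    then obtain u where u: "x = (\<Sum>a\<in>A. u a *\<^sub>R a)" "box {} u" "h x = real k" unfolding E_def by blast
    \<comment> \<open>Strictness comes from the coordinate at \<open>v\<close> alone, which stays
      below 1, while the others may equal 1.\<close>
    have "(\<Sum>a\<in>A. u a) < (\<Sum>a\<in>A. 1)"
    proof (rule sum_strict_mono_ex1[OF A(1)])
      show "\<forall>a\<in>A. u a \<le> 1" "\<exists>a\<in>A. u a < 1" using u(2) unfolding box_def A_def by auto
    qed
    then have "h x < real N * real (card A)" unfolding u(1) hsum using N by simp
    then have "h x < real k" using k by (metis of_nat_le_iff of_nat_mult order_less_le_trans)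
    then show False using u(3) by simp
  qed
  then show ?thesis
    unfolding quasi_poly_fps_def A_def[symmetric] EA[symmetric] *
    by (simp del: Collect_empty_eq add: slice_fps_def)
qed

section \<open>Pulling triangulations of cones\<close>

lemma convex_cone_hull_insert:
  "convex_cone hull (insert v V) = {s *\<^sub>R v + y | s y. 0 \<le> s \<and> y \<in> convex_cone hull V}"
proof -
  have "convex_cone hull {v} = {s *\<^sub>R v | s. 0 \<le> s}"
    by (auto simp: convex_cone_hull_separate_nonempty conic_hull_explicit)
  then show ?thesis
    using convex_cone_hull_Un[of "{v}" V] by auto
qed

text \<open>The open cone is open relative to the span of its generators: a small multiple of any
  vector of the span can be subtracted without leaving it.\<close>

lemma open_cone_perturb:
  fixes c :: "'a::real_vector \<Rightarrow> real"
  assumes S: "finite S" and y: "y \<in> open_cone S"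
  obtains e where "0 < e" "y - e *\<^sub>R (\<Sum>a\<in>S. c a *\<^sub>R a) \<in> open_cone S"
proof -
  obtain u where u: "y = (\<Sum>a\<in>S. u a *\<^sub>R a)" "\<forall>a\<in>S. 0 < u a" using y unfolding open_cone_def by blast
  \<comment> \<open>\<open>M\<close> exceeds every ratio of \<open>\<bar>c a\<bar>\<close> to
    \<open>u a\<close>, so the single step \<open>1 / M\<close> serves all coordinates; the summand
    1 keeps it positive.\<close>
  define M where "M = 1 + (\<Sum>a\<in>S. \<bar>c a\<bar> / u a)"
  have M: "1 \<le> M" unfolding M_def using u(2) by (simp add: sum_nonneg less_imp_le)
  have pos: "0 < u a - 1 / M * c a" if a: "a \<in> S" for a
  proof -
    have ua: "0 < u a" using u(2) a by blast
    have "\<bar>c a\<bar> / u a \<le> (\<Sum>a\<in>S. \<bar>c a\<bar> / u a)"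
      by (rule member_le_sum[OF a]) (use u(2) S in \<open>auto simp: less_imp_le\<close>)
    then have "\<bar>c a\<bar> / u a < M" unfolding M_def by simp
    then have "\<bar>c a\<bar> < M * u a" using ua by (simp add: pos_divide_less_eq)
    then have "c a < M * u a" by linarith
    then show ?thesis using M by (simp add: field_simps)
  qed
  show ?thesis
  proof (rule that)
    show "0 < 1 / M" using M by simp
    have "y - (1 / M) *\<^sub>R (\<Sum>a\<in>S. c a *\<^sub>R a) = (\<Sum>a\<in>S. (u a - 1 / M * c a) *\<^sub>R a)"
      unfolding u(1) scaleR_sum_right sum_subtractf[symmetric]
      by (intro sum.cong refl) (simp add: scaleR_diff_left)
    then show "y - (1 / M) *\<^sub>R (\<Sum>a\<in>S. c a *\<^sub>R a) \<in> open_cone S"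
      unfolding open_cone_def using pos
      by (intro CollectI exI[of _ "\<lambda>a. u a - 1 / M * c a"]) blast
  qed
qed

lemma open_cone_nonempty: "open_cone S \<noteq> {}"
proof -
  have "(\<Sum>a\<in>S. 1 *\<^sub>R a) \<in> open_cone S" unfolding open_cone_def by (intro CollectI exI[of _ "\<lambda>_. 1"]) auto
  then show ?thesis by blast
qed

lemma linear_nonneg_convex_cone_hull:
  assumes h: "linear h" and V: "\<And>a. a \<in> V \<Longrightarrow> 0 < (h a :: real)" and x: "x \<in> convex_cone hull V"
  shows "0 \<le> h x"
proof -
  have "convex_cone {x. 0 \<le> h x}"
    unfolding convex_cone_def convex_def conic_def
    by (auto simp: linear_add[OF h] linear_cmul[OF h] linear_0[OF h] intro: exI[of _ 0])
  then have "convex_cone hull V \<subseteq> {x. 0 \<le> h x}"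
    using V by (intro hull_minimal) (auto intro: less_imp_le)
  then show ?thesis using x by blast
qed

text \<open>A triangulation of the cone into relatively open simplicial cells; for finite
  \<open>V\<close> the apex is the cell of the empty set, whose open cone is \<open>{0}\<close>.
  Only disjointness is recorded, not how faces meet.\<close>

definition cone_partition :: "'a::real_vector set set \<Rightarrow> 'a set \<Rightarrow> bool" where
  "cone_partition \<T> V \<longleftrightarrow> finite \<T> \<and> (\<forall>S\<in>\<T>. S \<subseteq> V \<and> independent S) \<and>
     convex_cone hull V = (\<Union>S\<in>\<T>. open_cone S) \<and>
     (\<forall>S\<in>\<T>. \<forall>T\<in>\<T>. S \<noteq> T \<longrightarrow> open_cone S \<inter> open_cone T = {})"

lemma cone_partitionD:
  assumes "cone_partition \<T> V" and V: "finite V"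
  shows "finite \<T>" and "\<And>S. S \<in> \<T> \<Longrightarrow> S \<subseteq> V"
    and "\<And>S. S \<in> \<T> \<Longrightarrow> independent S" and "\<And>S. S \<in> \<T> \<Longrightarrow> finite S"
  using assms(1) finite_subset[OF _ V] unfolding cone_partition_def by auto

text \<open>Each point of the larger cone is moved in direction \<open>- v\<close> until it is about
  to leave. The end point lies in the visible part \<open>D\<close> of the cone over
  \<open>V\<close> and, together with the distance travelled, is unique. As \<open>D\<close> is a
  union of cells, the rays in direction \<open>v\<close> over these cells partition the larger
  cone.\<close>

lemma pulling_half_open_partition:
  fixes V :: "'a::euclidean_space set"
  assumes V: "finite V" and h: "linear h" and hpos: "\<And>a. a \<in> insert v V \<Longrightarrow> 0 < (h a :: real)"
    and T: "cone_partition \<T> V"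
  obtains \<U> where "\<U> \<subseteq> \<T>" "\<And>S. S \<in> \<U> \<Longrightarrow> v \<notin> S \<and> independent (insert v S)"
    "convex_cone hull (insert v V) = (\<Union>S\<in>\<U>. half_open_cone v S)"
    "\<And>S T. S \<in> \<U> \<Longrightarrow> T \<in> \<U> \<Longrightarrow> S \<noteq> T \<Longrightarrow> half_open_cone v S \<inter> half_open_cone v T = {}"
proof -
  let ?C = "convex_cone hull V" and ?C' = "convex_cone hull (insert v V)"
  \<comment> \<open>The part of the cone over \<open>V\<close> visible from \<open>- v\<close>; it turns out to be a union of cells.\<close>
  define D where "D = {y \<in> ?C. \<forall>e>0. y - e *\<^sub>R v \<notin> ?C'}"
  define \<U> where "\<U> = {S \<in> \<T>. open_cone S \<subseteq> D}"
  have Tsub: "S \<subseteq> V" "independent S" "finite S" if "S \<in> \<T>" for S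
    using cone_partitionD(2-4)[OF T V that] by auto
  have CT: "?C = (\<Union>S\<in>\<T>. open_cone S)" using T unfolding cone_partition_def by blast
  have CC': "?C \<subseteq> ?C'" by (rule hull_mono) blast
  have scaled: "s *\<^sub>R v + y \<in> ?C'" if "0 \<le> s" "y \<in> ?C" for s y
    using that unfolding convex_cone_hull_insert by blast
  \<comment> \<open>A cell meeting \<open>D\<close> lies in \<open>D\<close>: if \<open>y'\<close>
    in the cell of \<open>y\<close> could be moved back by \<open>e\<close>, then \<open>y\<close>,
    written as \<open>y - d *\<^sub>R y'\<close> plus \<open>d *\<^sub>R y'\<close>, could be moved
    back by \<open>d * e\<close>.\<close>
  have sub: "S \<in> \<U>" if S: "S \<in> \<T>" and y: "y \<in> open_cone S" "y \<in> D" for S y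
  proof -
    have "y' \<in> D" if y': "y' \<in> open_cone S" for y'
      unfolding D_def
    proof (intro CollectI conjI allI impI notI)
      show "y' \<in> ?C" using CT S y' by blast
      fix e :: real assume e: "0 < e" and mem: "y' - e *\<^sub>R v \<in> ?C'"
      obtain u where u: "y' = (\<Sum>a\<in>S. u a *\<^sub>R a)" using y' unfolding open_cone_def by blast
      obtain d where d: "0 < d" "y - d *\<^sub>R y' \<in> open_cone S"
        using open_cone_perturb[OF Tsub(3)[OF S] y(1), of u] unfolding u by blast
      have "y - d *\<^sub>R y' \<in> ?C'" using d(2) CT S CC' by blast
      then have "(y - d *\<^sub>R y') + d *\<^sub>R (y' - e *\<^sub>R v) \<in> ?C'"
        using mem d(1) by (intro convex_cone_hull_add convex_cone_hull_mul) auto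
      then have "y - (d * e) *\<^sub>R v \<in> ?C'" by (simp add: algebra_simps)
      moreover have "0 < d * e" using d e by simp
      ultimately show False using y(2) unfolding D_def by blast
    qed
    then show ?thesis using S unfolding \<U>_def by blast
  qed
  \<comment> \<open>Otherwise a point of the cell could be moved slightly in direction
    \<open>- v\<close> inside the cell itself, and would not be visible.\<close>
  have vspan: "v \<notin> span S" if S: "S \<in> \<U>" for S
  proof
    assume "v \<in> span S"
    have ST: "S \<in> \<T>" "open_cone S \<subseteq> D" using S unfolding \<U>_def by blast+
    obtain c where c: "v = (\<Sum>a\<in>S. c a *\<^sub>R a)"
      using \<open>v \<in> span S\<close> unfolding span_finite[OF Tsub(3)[OF ST(1)]] by blast
    obtain y where y: "y \<in> open_cone S" using open_cone_nonempty by blast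
    obtain e where e: "0 < e" "y - e *\<^sub>R v \<in> open_cone S"
      using open_cone_perturb[OF Tsub(3)[OF ST(1)] y, of c] unfolding c by blast
    have "y - e *\<^sub>R v \<in> ?C'" using e(2) CT CC' ST(1) by blast
    then show False using y ST(2) e(1) unfolding D_def by blast
  qed
  \<comment> \<open>If two decompositions had different distances, the visible point with the
    smaller distance could be moved back by the difference and reach the other one.\<close>
  have unique: "s = s' \<and> y = y'"
    if eq: "s *\<^sub>R v + y = s' *\<^sub>R v + y'" and y: "y \<in> D" "y' \<in> D" for s s' y y'
  proof -
    have "\<not> a < b" if eq: "a *\<^sub>R v + z = b *\<^sub>R v + w" and z: "z \<in> D" "w \<in> D" for a b z w
    proof
      assume "a < b"
      have "w = z - (b - a) *\<^sub>R v" using eq by (simp add: algebra_simps)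
      then have "z - (b - a) *\<^sub>R v \<in> ?C'" using z(2) CC' unfolding D_def by blast
      moreover have "0 < b - a" using \<open>a < b\<close> by simp
      ultimately show False using z(1) unfolding D_def by blast
    qed
    from this[OF eq y] this[OF eq[symmetric] y(2,1)] have "s = s'" by linarith
    then show ?thesis using eq by simp
  qed
  have exists: "\<exists>s y. 0 \<le> s \<and> y \<in> D \<and> x = s *\<^sub>R v + y" if x: "x \<in> ?C'" for x
  proof -
    \<comment> \<open>\<open>?K\<close> is the set of admissible distances. It is bounded because
      \<open>h\<close> is nonnegative on the cone and positive at \<open>v\<close>, and closed
      because finitely generated cones are closed, so a largest distance exists.\<close>
    let ?K = "{s. 0 \<le> s \<and> x - s *\<^sub>R v \<in> ?C'}"
    have hv: "0 < h v" using hpos by blast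
    have "s \<le> h x / h v" if s: "s \<in> ?K" for s
    proof -
      have "0 \<le> h (x - s *\<^sub>R v)"
        using linear_nonneg_convex_cone_hull[OF h hpos] s by blast
      then show ?thesis using hv by (simp add: linear_diff[OF h] linear_cmul[OF h] field_simps)
    qed
    then have "?K \<subseteq> {0..h x / h v}" by auto
    then have "bounded ?K" using bounded_subset bounded_closed_interval by blast
    moreover have "closed ((\<lambda>s. x - s *\<^sub>R v) -` ?C')"
      using V by (intro closed_vimage closed_convex_cone_hull continuous_intros) auto
    then have "closed ({0..} \<inter> (\<lambda>s. x - s *\<^sub>R v) -` ?C')" by (intro closed_Int) auto
    then have "closed ?K" by (simp add: Int_def)
    ultimately have "compact ?K" by (simp add: compact_eq_bounded_closed)
    moreover have "0 \<in> ?K" using x by simp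
    ultimately obtain s where s: "s \<in> ?K" "\<forall>t\<in>?K. t \<le> s"
      using compact_attains_sup[of ?K] by blast
    have max: "x - s *\<^sub>R v - e *\<^sub>R v \<notin> ?C'" if e: "0 < e" for e
    proof
      assume "x - s *\<^sub>R v - e *\<^sub>R v \<in> ?C'"
      then have "s + e \<in> ?K" using s(1) e by (simp add: algebra_simps)
      then have "s + e \<le> s" using s(2) by blast
      then show False using e by simp
    qed
    obtain r y where ry: "0 \<le> r" "y \<in> ?C" "x - s *\<^sub>R v = r *\<^sub>R v + y"
      using s(1) unfolding convex_cone_hull_insert by blast
    \<comment> \<open>A positive \<open>r\<close> would permit a further move of length
      \<open>r\<close>; hence the end point already lies in the cone over \<open>V\<close>.\<close>
    have "r = 0"
    proof (rule ccontr)
      assume "r \<noteq> 0"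
      moreover have "x - s *\<^sub>R v - r *\<^sub>R v = y" using ry(3) by (simp add: algebra_simps)
      ultimately show False using max[of r] ry CC' by auto
    qed
    then have "x - s *\<^sub>R v \<in> D" using ry max unfolding D_def by auto
    moreover have "x = s *\<^sub>R v + (x - s *\<^sub>R v)" by simp
    ultimately show ?thesis using s(1) by blast
  qed
  show ?thesis
  proof (rule that[of \<U>])
    show "\<U> \<subseteq> \<T>" unfolding \<U>_def by blast
    show "v \<notin> S \<and> independent (insert v S)" if S: "S \<in> \<U>" for S
      using vspan[OF S] Tsub(2)[of S] S span_base[of v S] unfolding \<U>_def
      by (auto simp: independent_insert)
    show "?C' = (\<Union>S\<in>\<U>. half_open_cone v S)"
    proof (intro equalityI subsetI)
      fix x assume "x \<in> ?C'"
      then obtain s y where sy: "0 \<le> s" "y \<in> D" "x = s *\<^sub>R v + y" using exists by blast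
      then obtain S where S: "S \<in> \<T>" "y \<in> open_cone S" using CT unfolding D_def by blast
      then have "S \<in> \<U>" using sub sy(2) by blast
      then show "x \<in> (\<Union>S\<in>\<U>. half_open_cone v S)" using S(2) sy unfolding half_open_cone_def by blast
    next
      fix x assume "x \<in> (\<Union>S\<in>\<U>. half_open_cone v S)"
      then show "x \<in> ?C'" using scaled CT unfolding half_open_cone_def \<U>_def by blast
    qed
    show "half_open_cone v S \<inter> half_open_cone v S' = {}"
      if S: "S \<in> \<U>" "S' \<in> \<U>" "S \<noteq> S'" for S S'
    proof (intro equals0I)
      fix x assume x: "x \<in> half_open_cone v S \<inter> half_open_cone v S'"
      obtain s y where sy: "x = s *\<^sub>R v + y" "y \<in> open_cone S" using x unfolding half_open_cone_def by blast
      obtain s' y' where sy': "x = s' *\<^sub>R v + y'" "y' \<in> open_cone S'" using x unfolding half_open_cone_def by blast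
      have "y \<in> D" "y' \<in> D" using S sy sy' unfolding \<U>_def by blast+
      then have "y = y'" using unique[of s y s' y'] sy(1) sy'(1) by simp
      then show False using S sy(2) sy'(2) T unfolding \<U>_def cone_partition_def by blast
    qed
  qed
qed

text \<open>The two pieces are the cases of zero and positive coefficient at \<open>v\<close>. This
  turns half-open cones back into open cells, which the inductive construction of a partition
  requires.\<close>

lemma half_open_cone_split:
  assumes S: "finite S" "v \<notin> S" and ind: "independent (insert v S)"
  shows "half_open_cone v S = open_cone S \<union> open_cone (insert v S)"
    and "open_cone S \<inter> open_cone (insert v S) = {}"
proof -
  have ins: "open_cone (insert v S) = {s *\<^sub>R v + y | s y. 0 < s \<and> y \<in> open_cone S}"
  proof (intro equalityI subsetI)
    fix x assume "x \<in> open_cone (insert v S)"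
    then obtain u where u: "x = (\<Sum>a\<in>insert v S. u a *\<^sub>R a)" "\<forall>a\<in>insert v S. 0 < u a"
      unfolding open_cone_def by blast
    have "x = u v *\<^sub>R v + (\<Sum>a\<in>S. u a *\<^sub>R a)" using u(1) S by simp
    then show "x \<in> {s *\<^sub>R v + y | s y. 0 < s \<and> y \<in> open_cone S}"
      using u(2) unfolding open_cone_def by blast
  next
    fix x assume "x \<in> {s *\<^sub>R v + y | s y. 0 < s \<and> y \<in> open_cone S}"
    then obtain s u where u: "x = s *\<^sub>R v + (\<Sum>a\<in>S. u a *\<^sub>R a)" "0 < s" "\<forall>a\<in>S. 0 < u a"
      unfolding open_cone_def by blast
    have "(\<Sum>a\<in>S. (u(v := s)) a *\<^sub>R a) = (\<Sum>a\<in>S. u a *\<^sub>R a)"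
      by (rule sum.cong) (use S(2) in auto)
    then have "x = (\<Sum>a\<in>insert v S. (u(v := s)) a *\<^sub>R a)" unfolding u(1) using S by simp
    moreover have "\<forall>a\<in>insert v S. 0 < (u(v := s)) a" using u by simp
    ultimately show "x \<in> open_cone (insert v S)" unfolding open_cone_def by blast
  qed
  show "half_open_cone v S = open_cone S \<union> open_cone (insert v S)"
    unfolding ins half_open_cone_def by (force simp: less_le)
  show "open_cone S \<inter> open_cone (insert v S) = {}"
  proof (intro equals0I)
    fix x assume x: "x \<in> open_cone S \<inter> open_cone (insert v S)"
    obtain u where u: "x = (\<Sum>a\<in>S. u a *\<^sub>R a)" using x unfolding open_cone_def by blast
    obtain w where w: "x = (\<Sum>a\<in>insert v S. w a *\<^sub>R a)" "0 < w v" using x unfolding open_cone_def by blast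
    have "(\<Sum>a\<in>S. (u(v := 0)) a *\<^sub>R a) = (\<Sum>a\<in>S. u a *\<^sub>R a)"
      by (rule sum.cong) (use S(2) in auto)
    then have "(\<Sum>a\<in>insert v S. w a *\<^sub>R a) = (\<Sum>a\<in>insert v S. (u(v := 0)) a *\<^sub>R a)"
      using u w(1) S by simp
    from independent_sum_unique[OF ind _ this] S(1) have "w v = (u(v := 0)) v" by blast
    then show False using w(2) by simp
  qed
qed

text \<open>Generators are added one at a time: the new cells are the visible old cells and their
  joins with the new generator. The induction starts from the single cell
  \<open>{0}\<close>.\<close>

lemma cone_partition_exists:
  fixes V :: "'a::euclidean_space set"
  assumes "finite V" and h: "linear h" and "\<And>a. a \<in> V \<Longrightarrow> 0 < (h a :: real)"
  obtains \<T> where "cone_partition \<T> V"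
  using assms(1,3)
proof (induction V arbitrary: thesis rule: finite_induct)
  case empty
  have "open_cone {} = {0 :: 'a}" unfolding open_cone_def by auto
  then have "cone_partition {{}} ({} :: 'a set)" unfolding cone_partition_def
    by (simp add: real_vector.independent_empty)
  then show ?case using empty by blast
next
  case (insert v V)
  obtain \<T> where T: "cone_partition \<T> V" using insert.IH insert.prems(2) by blast
  obtain \<U> where U: "\<U> \<subseteq> \<T>" "\<And>S. S \<in> \<U> \<Longrightarrow> v \<notin> S \<and> independent (insert v S)"
    "convex_cone hull (insert v V) = (\<Union>S\<in>\<U>. half_open_cone v S)"
    "\<And>S T. S \<in> \<U> \<Longrightarrow> T \<in> \<U> \<Longrightarrow> S \<noteq> T \<Longrightarrow> half_open_cone v S \<inter> half_open_cone v T = {}"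
    using pulling_half_open_partition[OF insert.hyps(1) h insert.prems(2) T] by blast
  have Usub: "S \<subseteq> V" "independent S" "finite S" if "S \<in> \<U>" for S
    using cone_partitionD(2-4)[OF T insert.hyps(1)] U(1) that by auto
  have split: "half_open_cone v S = open_cone S \<union> open_cone (insert v S)"
    "open_cone S \<inter> open_cone (insert v S) = {}" if "S \<in> \<U>" for S
    using half_open_cone_split[of S v] Usub(3)[OF that] U(2)[OF that] by blast+
  have "cone_partition (\<U> \<union> insert v ` \<U>) (insert v V)"
    unfolding cone_partition_def
  proof (intro conjI ballI impI)
    show "finite (\<U> \<union> insert v ` \<U>)"
      using finite_subset[OF U(1) cone_partitionD(1)[OF T insert.hyps(1)]] by simp
    show "S \<subseteq> insert v V" "independent S" if "S \<in> \<U> \<union> insert v ` \<U>" for S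
      using that Usub U(2) by blast+
    show "convex_cone hull insert v V = (\<Union>S\<in>\<U> \<union> insert v ` \<U>. open_cone S)"
      unfolding U(3) using split(1) by auto
    fix S S' assume S: "S \<in> \<U> \<union> insert v ` \<U>" "S' \<in> \<U> \<union> insert v ` \<U>" "S \<noteq> S'"
    obtain R where R: "R \<in> \<U>" "S = R \<or> S = insert v R" using S by blast
    obtain R' where R': "R' \<in> \<U>" "S' = R' \<or> S' = insert v R'" using S by blast
    show "open_cone S \<inter> open_cone S' = {}"
    proof (cases "R = R'")
      case True
      then show ?thesis using R R' S(3) split(2)[OF R(1)] by blast
    next
      case False
      then have "half_open_cone v R \<inter> half_open_cone v R' = {}" using U(4) R R' by blast
      then show ?thesis using R(2) R'(2) split(1)[OF R(1)] split(1)[OF R'(1)] by blast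
    qed
  qed
  then show ?case using insert.prems(1) by blast
qed

text \<open>The last generator \<open>v\<close> is added without splitting its half-open cones.
  Fully open cells would have boxes containing the sum of all their generators, of height exactly
  \<open>N\<close> times their number, and the strict degree bound would fail for them.\<close>

lemma quasi_poly_lattice_cone:
  fixes V L :: "'a::euclidean_space set"
  assumes V: "finite V" "V \<noteq> {}" "V \<subseteq> L"
    and L: "\<And>x y. x \<in> L \<Longrightarrow> y \<in> L \<Longrightarrow> x + y \<in> L" "\<And>x y. x \<in> L \<Longrightarrow> y \<in> L \<Longrightarrow> x - y \<in> L"
    and h: "linear h" and hN: "\<And>a. a \<in> V \<Longrightarrow> h a = real N" and N: "0 < N"
    and fin: "\<And>t. finite {x \<in> L \<inter> convex_cone hull V. h x = real t}"
  shows "quasi_poly_fps N DIM('a) (slice_fps h (L \<inter> convex_cone hull V))"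
proof -
  obtain v where v: "v \<in> V" using V(2) by blast
  define W where "W = V - {v}"
  have VW: "V = insert v W" and W: "finite W" using v V(1) unfolding W_def by auto
  have hpos: "0 < h a" if "a \<in> insert v W" for a using hN that N unfolding VW[symmetric] by simp
  obtain \<T> where T: "cone_partition \<T> W" using cone_partition_exists[OF W h] hpos by blast
  obtain \<U> where U: "\<U> \<subseteq> \<T>" "\<And>S. S \<in> \<U> \<Longrightarrow> v \<notin> S \<and> independent (insert v S)"
    "convex_cone hull (insert v W) = (\<Union>S\<in>\<U>. half_open_cone v S)"
    "\<And>S T. S \<in> \<U> \<Longrightarrow> T \<in> \<U> \<Longrightarrow> S \<noteq> T \<Longrightarrow> half_open_cone v S \<inter> half_open_cone v T = {}"
    using pulling_half_open_partition[OF W h hpos T] by blast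
  have finU: "finite \<U>" by (rule finite_subset[OF U(1) cone_partitionD(1)[OF T W]])
  have Usub: "S \<subseteq> W" "finite S" if "S \<in> \<U>" for S
    using cone_partitionD(2,4)[OF T W] U(1) that by auto
  have "slice_fps h (L \<inter> convex_cone hull V) = (\<Sum>S\<in>\<U>. slice_fps h (L \<inter> half_open_cone v S))"
    using U(4) by (intro slice_fps_UN[OF finU fin]) (auto simp: VW U(3))
  moreover have "quasi_poly_fps N DIM('a) (slice_fps h (L \<inter> half_open_cone v S))" if S: "S \<in> \<U>" for S
  proof (rule quasi_poly_fps_mono)
    show "quasi_poly_fps N (card (insert v S)) (slice_fps h (L \<inter> half_open_cone v S))"
    proof (rule quasi_poly_half_open_cone[OF _ Usub(2)[OF S] _ h hN N L])
      show "independent (insert v S)" "v \<notin> S" using U(2)[OF S] by blast+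
      show "a \<in> V" if "a \<in> insert v S" for a using that Usub(1)[OF S] unfolding VW by blast
      show "insert v S \<subseteq> L" using Usub(1)[OF S] V(3) unfolding VW by blast
      show "finite {x \<in> L \<inter> half_open_cone v S. h x = real t}" for t
        using S by (intro finite_subset[OF _ fin[of t]]) (auto simp: VW U(3))
    qed
    show "card (insert v S) \<le> DIM('a)" using independent_bound U(2)[OF S] by blast
  qed
  ultimately show ?thesis using quasi_poly_fps_sum by metis
qed

section \<open>Equivariant Ehrhart series\<close>

lemma fps_nth_mult_one_minus_X_power_apply:
  fixes F :: "('g \<Rightarrow> 'a::comm_ring_1) fps"
  shows "fps_nth (F * (1 - fps_X ^ N) ^ n) k g =
    fps_nth (Abs_fps (\<lambda>t. fps_nth F t g) * (1 - fps_X ^ N) ^ n) k"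
proof (induction n arbitrary: k)
  case (Suc n)
  show ?case
    unfolding power_Suc2 mult.assoc[symmetric] fps_nth_mult_one_minus_X_power by (simp add: Suc)
qed simp

lemma fps_nth_mult_one_minus_X_power_in_character_ring:
  fixes F :: "('g \<Rightarrow> complex) fps"
  assumes "\<And>t. fps_nth F t \<in> character_ring G"
  shows "fps_nth (F * (1 - fps_X ^ N) ^ n) k \<in> character_ring G"
proof (induction n arbitrary: k)
  case (Suc n)
  have "(if N \<le> k then fps_nth (F * (1 - fps_X ^ N) ^ n) (k - N) else 0) \<in> character_ring G"
    using Suc character_ring_0[of G] by (simp add: zero_fun_def)
  from character_ring_diff[OF Suc this] show ?case
    unfolding power_Suc2 mult.assoc[symmetric] fps_nth_mult_one_minus_X_power fun_diff_def .
qed (simp add: assms)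

text \<open>The coefficient ring has zero divisors, so cancellation must come from a genuine inverse
  of \<open>U\<close>. It exists because the constant coefficient 1 is its own pointwise
  inverse.\<close>

lemma fps_divide_eqI:
  fixes F H U :: "('g \<Rightarrow> complex) fps"
  assumes "F * U = H" "fps_nth U 0 = 1"
  shows "F = H / U"
proof -
  have inv1: "inverse (1 :: 'g \<Rightarrow> complex) = 1" by (simp add: fun_eq_iff)
  have "U * inverse U = 1"
    unfolding fps_inverse_def by (rule fps_right_inverse) (simp add: assms(2) inv1)
  then have "F = H * inverse U" unfolding assms(1)[symmetric] mult.assoc by simp
  also have "\<dots> = H / U" using assms(2) by (intro fps_divide_unit[symmetric]) simp
  finally show ?thesis .
qed

lemma fps_eq_poly_quotient:
  fixes F :: "('g \<Rightarrow> complex) fps"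
  assumes N: "0 < N" and F: "quasi_poly_fps N n F"
  obtains H where "degree H \<le> N * n - 1" "\<And>k. poly.coeff H k = fps_nth (F * (1 - fps_X ^ N) ^ n) k"
    "F = fps_of_poly H / (1 - fps_X ^ N) ^ n"
proof -
  let ?U = "(1 - fps_X ^ N) ^ n :: ('g \<Rightarrow> complex) fps"
  \<comment> \<open>Coefficients past the end of the list default to 0, which agrees with the series
    by the assumption on \<open>F\<close>.\<close>
  define H where "H = Poly (map (fps_nth (F * ?U)) [0..<N * n])"
  have coeff: "poly.coeff H k = fps_nth (F * ?U) k" for k
    using F unfolding H_def quasi_poly_fps_def by (auto simp: nth_default_def)
  have "degree H \<le> N * n - 1"
    using F unfolding quasi_poly_fps_def by (intro degree_le) (auto simp: coeff)
  \<comment> \<open>Positivity of \<open>N\<close> matters here: for \<open>N = 0\<close> the base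
    \<open>1 - fps_X ^ N\<close> would be zero.\<close>
  moreover have "fps_nth ?U 0 = 1" using N by (cases N) (simp_all add: fps_power_zeroth)
  then have "F = fps_of_poly H / ?U"
    by (intro fps_divide_eqI fps_ext) (simp_all add: coeff)
  ultimately show ?thesis using that coeff by blast
qed

lemma group_exponent:
  assumes "group G" "finite (carrier G)"
  shows "0 < group_exponent G" and "\<And>g. g \<in> carrier G \<Longrightarrow> g [^]\<^bsub>G\<^esub> group_exponent G = \<one>\<^bsub>G\<^esub>"
proof -
  interpret group G by fact
  let ?P = "\<lambda>n. 0 < n \<and> (\<forall>g\<in>carrier G. g [^]\<^bsub>G\<^esub> n = \<one>\<^bsub>G\<^esub>)"
  \<comment> \<open>By Lagrange the group order is a candidate, so the least exponent is
    attained.\<close>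
  have "?P (order G)" using assms(2) pow_order_eq_1 by (simp add: order_gt_0_iff_finite)
  then have "?P (group_exponent G)" unfolding group_exponent_def by (rule LeastI)
  then show "0 < group_exponent G" "\<And>g. g \<in> carrier G \<Longrightarrow> g [^]\<^bsub>G\<^esub> group_exponent G = \<one>\<^bsub>G\<^esub>" by blast+
qed

section \<open>Lattices and integral height functions\<close>

lemma full_lattice_closed:
  assumes L: "full_lattice L"
  shows "0 \<in> L" "x \<in> L \<Longrightarrow> y \<in> L \<Longrightarrow> x + y \<in> L" "x \<in> L \<Longrightarrow> y \<in> L \<Longrightarrow> x - y \<in> L"
proof -
  obtain B where B: "L = range (\<lambda>c. \<Sum>b\<in>B. of_int (c b) *\<^sub>R b)" using L unfolding full_lattice_def by blast
  show "0 \<in> L" unfolding B by (rule range_eqI[of _ _ "\<lambda>_. 0"]) simp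
  assume "x \<in> L" "y \<in> L"
  then obtain c e where ce: "x = (\<Sum>b\<in>B. of_int (c b) *\<^sub>R b)" "y = (\<Sum>b\<in>B. of_int (e b) *\<^sub>R b)"
    unfolding B by blast
  show "x + y \<in> L" unfolding B ce
    by (rule range_eqI[of _ _ "\<lambda>b. c b + e b"]) (simp add: scaleR_add_left sum.distrib)
  show "x - y \<in> L" unfolding B ce
    by (rule range_eqI[of _ _ "\<lambda>b. c b - e b"]) (simp add: scaleR_diff_left sum_subtractf)
qed

lemma full_lattice_sum:
  assumes "full_lattice L" "\<And>i. i \<in> I \<Longrightarrow> f i \<in> L"
  shows "(\<Sum>i\<in>I. f i) \<in> L"
  using assms(2) by (induction I rule: infinite_finite_induct) (auto intro: full_lattice_closed[OF assms(1)])

text \<open>The coordinate functionals of a lattice basis are bounded linear, so on a bounded set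
  the integer coordinates are confined to a finite box.\<close>

lemma finite_bounded_Int_full_lattice:
  fixes L :: "'a::euclidean_space set"
  assumes L: "full_lattice L" and S: "bounded S"
  shows "finite (S \<inter> L)"
proof -
  obtain B where B: "independent B" "L = range (\<lambda>c. \<Sum>b\<in>B. of_int (c b) *\<^sub>R b)"
    using L unfolding full_lattice_def by blast
  have finB: "finite B" using independent_bound B(1) by blast
  obtain R where R: "\<And>x. x \<in> S \<Longrightarrow> norm x \<le> R" using S unfolding bounded_iff by blast
  have "\<exists>f :: 'a \<Rightarrow> real. linear f \<and> (\<forall>b'\<in>B. f b' = (if b' = b then 1 else 0))" for b
    using linear_independent_extend[OF B(1), of "\<lambda>b'. if b' = b then 1 else 0 :: real"] by blast
  then obtain f :: "'a \<Rightarrow> 'a \<Rightarrow> real" where f: "\<And>b. linear (f b)"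
    "\<And>b b'. b' \<in> B \<Longrightarrow> f b b' = (if b' = b then 1 else 0)" by metis
  have "\<exists>K. \<forall>x. \<bar>f b x\<bar> \<le> norm x * K" for b
    using bounded_linear.bounded[of "f b"] f(1) linear_conv_bounded_linear by fastforce
  then obtain K where K: "\<And>b x. \<bar>f b x\<bar> \<le> norm x * K b" by metis
  let ?I = "\<lambda>b. {- \<lceil>R * \<bar>K b\<bar>\<rceil>..\<lceil>R * \<bar>K b\<bar>\<rceil>}"
  have "S \<inter> L \<subseteq> (\<lambda>c. \<Sum>b\<in>B. of_int (c b) *\<^sub>R b) ` (Pi\<^sub>E B ?I)"
  proof
    fix x assume x: "x \<in> S \<inter> L"
    then obtain c where c: "x = (\<Sum>b\<in>B. of_int (c b) *\<^sub>R b)" unfolding B(2) by blast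
    have "restrict c B \<in> Pi\<^sub>E B ?I"
    proof (rule restrict_PiE_iff[THEN iffD2], intro ballI)
      fix b assume b: "b \<in> B"
      have "f b x = (\<Sum>b'\<in>B. of_int (c b') * f b b')"
        unfolding c linear_sum[OF f(1)] linear_cmul[OF f(1)] by simp
      also have "\<dots> = (\<Sum>b'\<in>B. if b' = b then of_int (c b') else 0)"
        by (rule sum.cong) (simp_all add: f(2))
      also have "\<dots> = of_int (c b)" using finB b by simp
      finally have "\<bar>of_int (c b)\<bar> \<le> norm x * K b" using K[of b x] by simp
      also have "\<dots> \<le> norm x * \<bar>K b\<bar>" by (intro mult_left_mono) auto
      also have "\<dots> \<le> R * \<bar>K b\<bar>" using R x by (intro mult_right_mono) auto
      finally have "\<bar>of_int (c b) :: real\<bar> \<le> of_int \<lceil>R * \<bar>K b\<bar>\<rceil>" by linarith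
      then show "c b \<in> ?I b" by (simp add: abs_le_iff)
    qed
    moreover have "x = (\<Sum>b\<in>B. of_int (restrict c B b) *\<^sub>R b)" unfolding c by (rule sum.cong) auto
    ultimately show "x \<in> (\<lambda>c. \<Sum>b\<in>B. of_int (c b) *\<^sub>R b) ` (Pi\<^sub>E B ?I)" by blast
  qed
  then show ?thesis by (rule finite_subset) (auto intro!: finite_imageI finite_PiE finB)
qed

text \<open>This supplies the height function on the ambient space from the integer coordinate,
  which is given only on the lattice. The linear map is prescribed on a lattice basis, and
  additivity forces agreement on integer combinations.\<close>

lemma full_lattice_additive_extend:
  fixes L :: "'a::euclidean_space set" and p :: "'a \<Rightarrow> int"
  assumes L: "full_lattice L" and p: "\<And>x y. x \<in> L \<Longrightarrow> y \<in> L \<Longrightarrow> p (x + y) = p x + p y"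
  obtains h :: "'a \<Rightarrow> real" where "linear h" "\<And>x. x \<in> L \<Longrightarrow> h x = of_int (p x)"
proof -
  obtain B where B: "independent B" "L = range (\<lambda>c. \<Sum>b\<in>B. of_int (c b) *\<^sub>R b)"
    using L unfolding full_lattice_def by blast
  have finB: "finite B" using independent_bound B(1) by blast
  obtain h :: "'a \<Rightarrow> real" where h: "linear h" "\<And>b. b \<in> B \<Longrightarrow> h b = of_int (p b)"
    using linear_independent_extend[OF B(1), of "\<lambda>b. of_int (p b)"] by blast
  have p0: "p 0 = 0" using p[of 0 0] full_lattice_closed(1)[OF L] by simp
  have pm: "p (- x) = - p x" if "x \<in> L" for x
  proof -
    have "- x \<in> L" using full_lattice_closed(3)[OF L full_lattice_closed(1)[OF L] that] by simp
    then show ?thesis using p[of "- x" x] that p0 by simp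
  qed
  have nat: "of_nat n *\<^sub>R x \<in> L \<and> p (of_nat n *\<^sub>R x) = of_nat n * p x" if "x \<in> L" for n x
    using that p0 p full_lattice_closed(1,2)[OF L] by (induction n) (auto simp: algebra_simps)
  have int: "of_int k *\<^sub>R x \<in> L \<and> p (of_int k *\<^sub>R x) = k * p x" if x: "x \<in> L" for k x
  proof (cases k)
    case (nonneg n)
    then show ?thesis using nat[OF x, of n] by simp
  next
    case (neg n)
    have mx: "- x \<in> L" using full_lattice_closed(3)[OF L full_lattice_closed(1)[OF L] x] by simp
    have eq: "of_int k *\<^sub>R x = of_nat (Suc n) *\<^sub>R (- x)"
      unfolding neg by (simp only: of_int_minus of_int_of_nat_eq scaleR_minus_left scaleR_minus_right)
    show ?thesis
      unfolding eq using nat[OF mx, of "Suc n"] pm[OF x]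
      by (simp only: neg mult_minus_left mult_minus_right simp_thms)
  qed
  have BL: "b \<in> L" if "b \<in> B" for b
    unfolding B(2)
  proof (rule range_eqI[of _ _ "\<lambda>b'. if b' = b then 1 else 0"])
    have "(\<Sum>b'\<in>B. of_int (if b' = b then 1 else 0) *\<^sub>R b') = (\<Sum>b'\<in>B. if b' = b then b' else 0)"
      by (rule sum.cong) auto
    then show "b = (\<Sum>b'\<in>B. of_int (if b' = b then 1 else 0) *\<^sub>R b')" using finB that by simp
  qed
  have "(\<Sum>b\<in>A. of_int (c b) *\<^sub>R b) \<in> L \<and>
      h (\<Sum>b\<in>A. of_int (c b) *\<^sub>R b) = of_int (p (\<Sum>b\<in>A. of_int (c b) *\<^sub>R b))" if "A \<subseteq> B" for A c
    using finite_subset[OF that finB] that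
  proof (induction A rule: finite_induct)
    case empty
    then show ?case using p0 full_lattice_closed(1)[OF L] linear_0[OF h(1)] by simp
  next
    case (insert b A)
    have b: "b \<in> B" using insert by simp
    let ?y = "of_int (c b) *\<^sub>R b" and ?z = "\<Sum>b\<in>A. of_int (c b) *\<^sub>R b"
    have z: "?z \<in> L" "h ?z = of_int (p ?z)" using insert by blast+
    have y: "?y \<in> L" "h ?y = of_int (p ?y)"
      using int[OF BL[OF b], of "c b"] h(2)[OF b] linear_cmul[OF h(1)] by simp_all
    have "(\<Sum>b\<in>insert b A. of_int (c b) *\<^sub>R b) = ?y + ?z" using insert.hyps by simp
    moreover have "h (?y + ?z) = of_int (p (?y + ?z))"
      using p[OF y(1) z(1)] y z linear_add[OF h(1)] by simp
    ultimately show ?case using full_lattice_closed(2)[OF L y(1) z(1)] by simp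
  qed
  then have "h x = of_int (p x)" if "x \<in> L" for x using that unfolding B(2) by blast
  then show ?thesis using that h(1) by blast
qed

text \<open>\<open>A\<close> is \<open>N\<close> times the projection onto the fixed space of
  \<open>f\<close>. Its images of vertices are fixed and lie in the cone over \<open>P\<close>;
  conversely, \<open>A\<close> multiplies a fixed point by \<open>N\<close>. The case
  \<open>t = 0\<close> is included: both sides then contain at most the origin.\<close>

lemma fixed_lattice_points_eq_cone:
  fixes P :: "'a::euclidean_space set" and f :: "'a \<Rightarrow> 'a"
  assumes N: "0 < N" and f: "linear f" and fN: "\<And>x. (f ^^ N) x = x"
    and h: "linear h" and P: "convex P" "P \<noteq> {}" "f ` P \<subseteq> P" and hP: "\<And>x. x \<in> P \<Longrightarrow> h x = (1 :: real)"
    and PV: "P = convex hull V"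
  defines "A \<equiv> \<lambda>x. \<Sum>j<N. (f ^^ j) x"
  shows "{x \<in> lattice_points_dilate L P t. f x = x} = {x \<in> L \<inter> convex_cone hull (A ` V). h x = real t}"
proof -
  have lin: "linear (f ^^ j)" for j
  proof (induction j)
    case 0
    show ?case by (simp add: id_def linear_ident)
  next
    case (Suc j)
    show ?case using linear_compose[OF Suc f] by (simp add: o_def)
  qed
  have linA: "linear A" unfolding A_def by (intro linear_compose_sum ballI lin)
  have fA: "f (A x) = A x" for x
  proof -
    have "f (A x) = (\<Sum>j<N. (f ^^ Suc j) x)" unfolding A_def linear_sum[OF f] by simp
    \<comment> \<open>The shifted sum trades the term for \<open>j = 0\<close> against that for
      \<open>j = N\<close>, and these agree because \<open>f ^^ N\<close> is the identity.\<close>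
    also have "\<dots> = A x" unfolding A_def sum.lessThan_Suc_shift[symmetric]
      using sum.lessThan_Suc_shift[of "\<lambda>j. (f ^^ j) x" N] sum.lessThan_Suc[of "\<lambda>j. (f ^^ j) x" N] fN by simp
    finally show ?thesis .
  qed
  have fP: "(f ^^ j) x \<in> P" if "x \<in> P" for x j
    using that P(3) by (induction j) auto
  have AP: "(1 / real N) *\<^sub>R A x \<in> P" if "x \<in> P" for x
  proof -
    have "(\<Sum>j<N. (1 / real N) *\<^sub>R (f ^^ j) x) \<in> P"
      using N fP[OF that] by (intro convex_sum[OF _ P(1)]) auto
    then show ?thesis unfolding A_def by (simp add: scaleR_sum_right)
  qed
  show ?thesis
  proof (intro equalityI subsetI)
    fix x assume x: "x \<in> {x \<in> lattice_points_dilate L P t. f x = x}"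
    then obtain p where p: "p \<in> P" "x = real t *\<^sub>R p" and xL: "x \<in> L" and fx: "f x = x"
      unfolding lattice_points_dilate_def by blast
    have "(f ^^ j) x = x" for j using fx by (induction j) auto
    then have "A x = real N *\<^sub>R x" unfolding A_def by (simp add: sum_constant_scaleR)
    then have "x = (1 / real N) *\<^sub>R A x" using N by simp
    also have "\<dots> = (real t / real N) *\<^sub>R A p" unfolding p(2) linear_cmul[OF linA] by simp
    finally have eq: "x = (real t / real N) *\<^sub>R A p" .
    have "A p \<in> convex hull (A ` V)"
      using p(1) unfolding PV convex_hull_linear_image[OF linA, symmetric] by blast
    then have "A p \<in> convex_cone hull (A ` V)" using convex_hull_subset_convex_cone_hull by blast
    then have "x \<in> convex_cone hull (A ` V)" unfolding eq by (rule convex_cone_hull_mul) simp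
    moreover have "h x = real t" using hP[OF p(1)] unfolding p(2) linear_cmul[OF h] by simp
    ultimately show "x \<in> {x \<in> L \<inter> convex_cone hull (A ` V). h x = real t}" using xL by blast
  next
    fix x assume x: "x \<in> {x \<in> L \<inter> convex_cone hull (A ` V). h x = real t}"
    have VP: "V \<subseteq> P" unfolding PV by (rule hull_subset)
    have "convex_cone hull (A ` V) \<subseteq> {x. f x = x}"
    proof (rule hull_minimal)
      show "A ` V \<subseteq> {x. f x = x}" using fA by blast
      show "convex_cone {x. f x = x}"
        unfolding convex_cone_def convex_def conic_def
        by (auto simp: linear_add[OF f] linear_cmul[OF f] linear_0[OF f] intro: exI[of _ 0])
    qed
    then have "f x = x" using x by blast
    have "A ` V \<subseteq> conic hull P"
    proof
      fix y assume "y \<in> A ` V"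
      then obtain v where v: "v \<in> V" "y = A v" by blast
      have "y = real N *\<^sub>R ((1 / real N) *\<^sub>R A v)" using N v(2) by simp
      moreover have "(1 / real N) *\<^sub>R A v \<in> P" using AP v(1) VP by blast
      ultimately show "y \<in> conic hull P" unfolding conic_hull_explicit using of_nat_0_le_iff by blast
    qed
    then have "convex_cone hull (A ` V) \<subseteq> conic hull P"
      by (rule hull_minimal) (simp add: convex_cone_def conic_hull_eq_empty P convex_conic_hull conic_conic_hull)
    then obtain s p where s: "p \<in> P" "x = s *\<^sub>R p" using x unfolding conic_hull_explicit by blast
    \<comment> \<open>As \<open>h\<close> is 1 on \<open>P\<close>, the height of a point of the
      cone over \<open>P\<close> is its dilation factor.\<close>
    have "s = real t" using x hP[OF s(1)] by (simp add: s(2) linear_cmul[OF h])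
    then show "x \<in> {x \<in> lattice_points_dilate L P t. f x = x}"
      using x s \<open>f x = x\<close> unfolding lattice_points_dilate_def by blast
  qed
qed

theorem theorem2p6:
  fixes G :: "('g, 'b) monoid_scheme"
    and d N :: nat
    and \<phi> :: "'g \<Rightarrow> 'a::euclidean_space \<Rightarrow> 'a"
    and M' P :: "'a set"
    and \<psi> :: "'a \<Rightarrow> 'm::ab_group_add \<times> int"
  assumes "group G" and "finite (carrier G)" and "N = group_exponent G"
    and "DIM('a) = d + 1" and "full_lattice M'"
    and "bij_betw \<psi> M' UNIV"
    and "\<forall>x\<in>M'. \<forall>y\<in>M'. \<psi> (x + y) = \<psi> x + \<psi> y"
    and "linear_lattice_action G \<phi> M'"
    and "\<forall>g\<in>carrier G. \<forall>x\<in>M'. snd (\<psi> (\<phi> g x)) = snd (\<psi> x)"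
    and "polytope P" and "aff_dim P = int d"
    and "\<forall>g\<in>carrier G. \<phi> g ` P = P"
    and "\<forall>v. v extreme_point_of P \<longrightarrow> v \<in> M' \<and> snd (\<psi> v) = 1"
  shows "\<exists>H :: ('g \<Rightarrow> complex) poly.
           degree H \<le> N * (d + 1) - 1 \<and>
           (\<forall>k. poly.coeff H k \<in> rational_character_ring G) \<and>
           Abs_fps (ehrhart_character G \<phi> M' P) = fps_of_poly H / (1 - fps_X ^ N) ^ (d + 1)"
proof -
  interpret G: group G by fact
  have action: "group_action G UNIV \<phi>"
    and lin: "\<And>g. g \<in> carrier G \<Longrightarrow> linear (\<phi> g)"
    and stable: "\<And>g x. g \<in> carrier G \<Longrightarrow> x \<in> M' \<Longrightarrow> \<phi> g x \<in> M'"
    using assms(8) unfolding linear_lattice_action_def by blast+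
  interpret group_action G UNIV \<phi> by (rule action)
  note lattice = full_lattice_closed[OF assms(5)]
  have N: "0 < N" and gN: "\<And>g. g \<in> carrier G \<Longrightarrow> g [^]\<^bsub>G\<^esub> N = \<one>\<^bsub>G\<^esub>"
    using group_exponent[OF assms(1,2)] unfolding assms(3) by blast+
  obtain h :: "'a \<Rightarrow> real" where h: "linear h" "\<And>x. x \<in> M' \<Longrightarrow> h x = of_int (snd (\<psi> x))"
    by (rule full_lattice_additive_extend[OF assms(5), of "\<lambda>x. snd (\<psi> x)"]) (use assms(7) in auto)
  define V where "V = {v. v extreme_point_of P}"
  have PV: "P = convex hull V"
    unfolding V_def using assms(10)
    by (intro Krein_Milman_Minkowski) (auto intro: polytope_imp_compact polytope_imp_convex)
  have finV: "finite V"
    unfolding V_def using assms(10) by (intro finite_polyhedron_extreme_points polytope_imp_polyhedron)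
  have Pne: "P \<noteq> {}" using assms(11) by auto
  have Vne: "V \<noteq> {}" using Pne unfolding PV by auto
  have VM: "v \<in> M'" "h v = 1" if "v \<in> V" for v
    using assms(13) that h(2)[of v] unfolding V_def by auto
  have hP: "h x = 1" if "x \<in> P" for x
  proof -
    have "convex hull V \<subseteq> {x. h x = 1}"
    proof (rule hull_minimal)
      show "convex {x. h x = 1}"
        unfolding convex_def by (auto simp: linear_add[OF h(1)] linear_cmul[OF h(1)])
    qed (use VM in auto)
    then show ?thesis using that PV by blast
  qed
  have iterate: "\<phi> (g [^]\<^bsub>G\<^esub> j) x = (\<phi> g ^^ j) x" if g: "g \<in> carrier G" for g j x
  proof (induction j arbitrary: x)
    case 0
    show ?case using id_eq_one by (simp add: fun_eq_iff)
  next
    case (Suc j)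
    have "\<phi> (g [^]\<^bsub>G\<^esub> Suc j) x = \<phi> (g [^]\<^bsub>G\<^esub> j) (\<phi> g x)"
      using composition_rule[of x "g [^]\<^bsub>G\<^esub> j" g] g by simp
    then show ?case unfolding Suc by (simp add: funpow_swap1)
  qed
  have finX: "finite (lattice_points_dilate M' P t)" for t
    unfolding lattice_points_dilate_def using assms(10)
    by (intro finite_bounded_Int_full_lattice[OF assms(5)] bounded_scaling polytope_imp_bounded)
  have invX: "\<phi> g x \<in> lattice_points_dilate M' P t"
    if g: "g \<in> carrier G" and x: "x \<in> lattice_points_dilate M' P t" for g x t
  proof -
    obtain p where p: "p \<in> P" "x = real t *\<^sub>R p" "x \<in> M'" using x unfolding lattice_points_dilate_def by blast
    have "\<phi> g x = real t *\<^sub>R \<phi> g p" unfolding p(2) by (rule linear_cmul[OF lin[OF g]])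
    moreover have "\<phi> g p \<in> P" using assms(12) g p(1) by blast
    ultimately show ?thesis using stable[OF g p(3)] unfolding lattice_points_dilate_def by blast
  qed
  \<comment> \<open>For \<open>t = 0\<close> the dilate is \<open>{0}\<close> because
    \<open>P\<close> is nonempty, so the constant coefficient is the trivial character.\<close>
  let ?F = "Abs_fps (ehrhart_character G \<phi> M' P)"
  have F_ring: "fps_nth ?F t \<in> character_ring G" for t
    using character_in_character_ring[OF G.is_monoid permutation_rep_matrix_rep[OF action finX invX]]
    by (simp add: ehrhart_character_def)
  have "quasi_poly_fps N (d + 1) ?F"
    unfolding quasi_poly_fps_def
  proof (intro allI impI ext)
    fix k g assume k: "N * (d + 1) \<le> k"
    show "fps_nth (?F * (1 - fps_X ^ N) ^ (d + 1)) k g = (0 :: 'g \<Rightarrow> complex) g"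
    proof (cases "g \<in> carrier G")
      case False
      \<comment> \<open>Off the carrier all characters are 0 by convention.\<close>
      then have "Abs_fps (\<lambda>t. fps_nth ?F t g) = 0"
        by (simp add: fps_eq_iff ehrhart_character_def character_def)
      then show ?thesis unfolding fps_nth_mult_one_minus_X_power_apply by simp
    next
      case True
      define W where "W = (\<lambda>x. \<Sum>j<N. (\<phi> g ^^ j) x) ` V"
      have points: "{x \<in> lattice_points_dilate M' P t. \<phi> g x = x} =
          {x \<in> M' \<inter> convex_cone hull W. h x = real t}" for t
        unfolding W_def
      proof (rule fixed_lattice_points_eq_cone[OF N lin[OF True] _ h(1) _ Pne _ hP PV])
        show "(\<phi> g ^^ N) x = x" for x
          using iterate[OF True, of N x] iterate[OF True, of 0 x] gN[OF True] by simp
        show "convex P" using assms(10) by (rule polytope_imp_convex)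
        show "\<phi> g ` P \<subseteq> P" using assms(12) True by blast
      qed
      \<comment> \<open>Every summand of a generator is a lattice point with the height of its
        vertex, which is 1; with \<open>N\<close> summands the generators lie in \<open>M'\<close>
        at height \<open>N\<close>.\<close>
      have pow: "(\<phi> g ^^ j) v \<in> M'" "h ((\<phi> g ^^ j) v) = h v" if v: "v \<in> M'" for j v
      proof -
        show "(\<phi> g ^^ j) v \<in> M'" for j using v stable[OF True] by (induction j) auto
        then show "h ((\<phi> g ^^ j) v) = h v"
          using assms(9) True h(2) stable[OF True] by (induction j) auto
      qed
      have "quasi_poly_fps N DIM('a) (slice_fps h (M' \<inter> convex_cone hull W))"
      proof (rule quasi_poly_lattice_cone[OF _ _ _ lattice(2,3) h(1) _ N])
        show "finite W" "W \<noteq> {}" unfolding W_def using finV Vne by auto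
        show "W \<subseteq> M'" unfolding W_def using VM(1) pow(1) by (auto intro!: full_lattice_sum[OF assms(5)])
        show "h a = real N" if "a \<in> W" for a
          using that VM pow(2) unfolding W_def by (auto simp: linear_sum[OF h(1)])
        show "finite {x \<in> M' \<inter> convex_cone hull W. h x = real t}" for t
          using finX[of t] unfolding points[symmetric] by simp
      qed
      \<comment> \<open>The permutation character at \<open>g\<close> counts fixed points, so the
        series evaluated at \<open>g\<close> is the Hilbert series of the cone of fixed
        points.\<close>
      moreover have "Abs_fps (\<lambda>t. fps_nth ?F t g) = slice_fps h (M' \<inter> convex_cone hull W)"
        using character_permutation_rep[OF finX True] points
        by (simp add: slice_fps_def ehrhart_character_def)
      ultimately show ?thesis
        unfolding fps_nth_mult_one_minus_X_power_apply using k assms(4)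
        by (simp add: quasi_poly_fps_def)
    qed
  qed
  from fps_eq_poly_quotient[OF N this] obtain H where H: "degree H \<le> N * (d + 1) - 1"
    "\<And>k. poly.coeff H k = fps_nth (?F * (1 - fps_X ^ N) ^ (d + 1)) k"
    "?F = fps_of_poly H / (1 - fps_X ^ N) ^ (d + 1)" by blast
  have "poly.coeff H k \<in> rational_character_ring G" for k
    unfolding H(2)
    using fps_nth_mult_one_minus_X_power_in_character_ring[OF F_ring] character_ring_subset_rational
    by blast
  then show ?thesis using H(1,3) by blast
qed

end
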